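(* Let $K_n$ denote the number of distinct unordered rooted trees represented by the fringe subtrees of a uniformly random binary tree of size $n$ (i.e., the number of classes of fringe subtrees, two fringe subtrees being identified if they are isomorphic as rooted unordered trees). Then there are constants $c_1\approx1.0591261434$ and $c_2\approx1.0761505454$ such that (i) $c_1\frac{n}{\sqrt{\log n}}(1+o(1))\le\mathbb{E}(K_n)\le c_2\frac{n}{\sqrt{\log n}}(1+o(1))$; (ii) with probability tending to $1$, $c_1\frac{n}{\sqrt{\log n}}(1+o(1))\le K_n\le c_2\frac{n}{\sqrt{\log n}}(1+o(1))$.
   Context: A binary tree is a rooted ordered tree in which every vertex has two possible positions (left, right) for children, each of which may or may not be occupied; size is the number of vertices. A fringe subtree is a vertex together with all its descendants. *)

theory Defs
  imports "HOL-Probability.Probability" "HOL-Library.Tree" "HOL-Library.Landau_Symbols"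
begin

text \<open>
  In the type \<^typ>\<open>unit tree\<close> the constructor \<^const>\<open>Leaf\<close> stands for an unoccupied position and
  \<^const>\<open>Node\<close> for a vertex, so \<^const>\<open>size\<close> counts vertices.
\<close>

definition binary_trees :: "nat \<Rightarrow> unit tree set" where
  "binary_trees n = {t. size t = n}"

definition random_binary_tree :: "nat \<Rightarrow> unit tree pmf" where
  "random_binary_tree n = pmf_of_set (binary_trees n)"

text \<open>The library's \<^const>\<open>subtrees\<close> also contains the empty tree, which is rooted at no vertex.\<close>

definition fringe_subtrees :: "'a tree \<Rightarrow> 'a tree set" where
  "fringe_subtrees t = subtrees t - {Leaf}"

datatype utree = UNode "utree multiset"

text \<open>The unordered rooted tree represented by a nonempty binary tree.\<close>

fun unordered :: "'a tree \<Rightarrow> utree" where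
  "unordered (Node l x r) =
     UNode ((if l = Leaf then {#} else {#unordered l#}) + (if r = Leaf then {#} else {#unordered r#}))"

definition num_unordered :: "'a tree \<Rightarrow> nat" where
  "num_unordered t = card (unordered ` fringe_subtrees t)"

lemma binary_trees_0: "binary_trees 0 = {Leaf}"
  by (auto simp: binary_trees_def)

lemma binary_trees_Suc:
  "binary_trees (Suc n) =
     (\<Union>k\<le>n. (\<lambda>(l, r). Node l () r) ` (binary_trees k \<times> binary_trees (n - k)))"
proof (rule set_eqI)
  fix t :: "unit tree"
  show "t \<in> binary_trees (Suc n) \<longleftrightarrow>
    t \<in> (\<Union>k\<le>n. (\<lambda>(l, r). Node l () r) ` (binary_trees k \<times> binary_trees (n - k)))"
    by (cases t) (auto simp: binary_trees_def image_iff)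
qed

lemma finite_binary_trees: "finite (binary_trees n)"
proof (induction n rule: less_induct)
  case (less n)
  then show ?case
    by (cases n) (auto simp: binary_trees_0 binary_trees_Suc less_Suc_eq_le)
qed

lemma binary_trees_nonempty: "binary_trees n \<noteq> {}"
proof (induction n)
  case (Suc n)
  then obtain t :: "unit tree" where "size t = n" by (auto simp: binary_trees_def)
  then have "Node t () Leaf \<in> binary_trees (Suc n)" by (simp add: binary_trees_def)
  then show ?case by blast
qed (simp add: binary_trees_0)

text \<open>
  Equality of the represented unordered trees is isomorphism of rooted unordered trees, that is,
  existence of a bijection of the vertices preserving the root and the parent-child relation.
  A vertex is encoded as the path leading to it from the root.
\<close>

fun vertices :: "'a tree \<Rightarrow> bool list set" where
  "vertices Leaf = {}"
| "vertices (Node l x r) = insert [] ((#) False ` vertices l \<union> (#) True ` vertices r)"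

definition rooted_iso :: "(bool list \<Rightarrow> bool list) \<Rightarrow> 'a tree \<Rightarrow> 'b tree \<Rightarrow> bool" where
  "rooted_iso f s t \<longleftrightarrow> bij_betw f (vertices s) (vertices t) \<and> f [] = [] \<and>
     (\<forall>p\<in>vertices s. \<forall>q\<in>vertices s. (\<exists>b. q = p @ [b]) \<longleftrightarrow> (\<exists>c. f q = f p @ [c]))"

fun child :: "bool \<Rightarrow> 'a tree \<Rightarrow> 'a tree" where
  "child b Leaf = Leaf"
| "child b (Node l x r) = (if b then r else l)"

lemma Nil_in_vertices: "[] \<in> vertices t \<longleftrightarrow> t \<noteq> Leaf"
  by (cases t) auto

lemma Cons_in_vertices: "b # p \<in> vertices t \<longleftrightarrow> p \<in> vertices (child b t)"
  by (cases t) auto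

lemma vertices_appendD: "p @ q \<in> vertices t \<Longrightarrow> p \<in> vertices t"
proof (induction p arbitrary: t)
  case Nil
  then show ?case by (cases t) auto
next
  case (Cons b p)
  then show ?case by (simp add: Cons_in_vertices)
qed

lemma size_child: "t \<noteq> Leaf \<Longrightarrow> size (child b t) < size t"
  by (cases t) auto

lemma unordered_eq_iff:
  assumes "s \<noteq> Leaf" "t \<noteq> Leaf"
  shows "unordered s = unordered t \<longleftrightarrow>
    (\<exists>g. bij g \<and> (\<forall>b. (child b s = Leaf \<longleftrightarrow> child (g b) t = Leaf) \<and>
       (child b s \<noteq> Leaf \<longrightarrow> unordered (child b s) = unordered (child (g b) t))))"
    (is "_ \<longleftrightarrow> (\<exists>g. ?P g)")
proof
  assume *: "unordered s = unordered t"
  obtain l x r l' x' r' where st: "s = Node l x r" "t = Node l' x' r'"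
    using assms by (metis tree.exhaust)
  have "bij Not" by (rule o_bij[of Not]) auto
  have "?P id \<or> ?P Not"
  proof (rule disjCI)
    assume "\<not> ?P Not"
    then have "\<not> (\<forall>b. (child b s = Leaf \<longleftrightarrow> child (\<not> b) t = Leaf) \<and>
       (child b s \<noteq> Leaf \<longrightarrow> unordered (child b s) = unordered (child (\<not> b) t)))"
      using \<open>bij Not\<close> by blast
    with * show "?P id"
      by (auto simp: st all_bool_eq add_eq_conv_ex split: if_splits)
  qed
  then show "\<exists>g. ?P g" by blast
next
  assume "\<exists>g. ?P g"
  then obtain g where g: "bij g" and
    *: "\<And>b. (child b s = Leaf \<longleftrightarrow> child (g b) t = Leaf)"
       "\<And>b. child b s \<noteq> Leaf \<Longrightarrow> unordered (child b s) = unordered (child (g b) t)"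
    by blast
  obtain l x r l' x' r' where st: "s = Node l x r" "t = Node l' x' r'"
    using assms by (metis tree.exhaust)
  from g have "g True \<noteq> g False" by (simp add: bij_is_inj inj_eq)
  then show "unordered s = unordered t"
    using *[of True] *[of False] by (cases "g True"; cases "g False") (auto simp: st)
qed

lemma rooted_iso_child:
  assumes "rooted_iso f s t" "s \<noteq> Leaf" "t \<noteq> Leaf"
  shows "\<exists>g h. bij g \<and> (\<forall>b. (child b s = Leaf \<longleftrightarrow> child (g b) t = Leaf) \<and>
       (child b s \<noteq> Leaf \<longrightarrow> rooted_iso (h b) (child b s) (child (g b) t)))"
proof -
  have bij: "bij_betw f (vertices s) (vertices t)" and f0: "f [] = []"
    and edge: "\<And>p q. p \<in> vertices s \<Longrightarrow> q \<in> vertices s \<Longrightarrow>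
        (\<exists>b. q = p @ [b]) \<longleftrightarrow> (\<exists>c. f q = f p @ [c])"
    using assms(1) by (auto simp: rooted_iso_def)
  have inj: "inj_on f (vertices s)" and img: "f ` vertices s = vertices t"
    using bij by (auto simp: bij_betw_def)
  define d where "d b = hd (f [b])" for b
  have d: "\<exists>q. f (b # p) = d b # q" if "b # p \<in> vertices s" for b p
    using that
  proof (induction p rule: rev_induct)
    case Nil
    have "\<exists>c. f [b] = f [] @ [c]"
      using edge[of "[]" "[b]"] Nil assms by (auto simp: Nil_in_vertices)
    then show ?case by (auto simp: f0 d_def)
  next
    case (snoc c p)
    have "(b # p) @ [c] \<in> vertices s" using snoc.prems by simp
    then have p: "b # p \<in> vertices s" by (rule vertices_appendD)
    have "\<exists>c'. f (b # p @ [c]) = f (b # p) @ [c']"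
      using edge[OF p snoc.prems] by auto
    then show ?case using snoc.IH[OF p] by auto
  qed
  define h where "h b p = tl (f (b # p))" for b p
  have fh: "f (b # p) = d b # h b p" if "b # p \<in> vertices s" for b p
    using d[OF that] by (auto simp: h_def)
  have d1: "f [b] = [d b]" if "[b] \<in> vertices s" for b
  proof -
    have "\<exists>c. f [b] = f [] @ [c]"
      using edge[of "[]" "[b]"] that assms by (auto simp: Nil_in_vertices)
    then show ?thesis by (auto simp: f0 d_def)
  qed
  have pres: "[b] \<in> vertices s \<longleftrightarrow> child b s \<noteq> Leaf" for b
    by (simp add: Cons_in_vertices Nil_in_vertices)
  have prest: "[b] \<in> vertices t \<longleftrightarrow> child b t \<noteq> Leaf" for b
    by (simp add: Cons_in_vertices Nil_in_vertices)
  have dinj: "b = b'" if "[b] \<in> vertices s" "[b'] \<in> vertices s" "d b = d b'" for b b'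
    using inj_onD[OF inj, of "[b]" "[b']"] that by (simp add: d1)
  have dim: "[d b] \<in> vertices t" if "[b] \<in> vertices s" for b
    using img that d1[OF that] by (metis imageI)
  have dsurj: "\<exists>b p. b # p \<in> vertices s \<and> d b = c \<and> h b p = q" if "c # q \<in> vertices t" for c q
  proof -
    have "c # q \<in> f ` vertices s" using img that by simp
    then obtain p where p: "p \<in> vertices s" "f p = c # q" by force
    then obtain b p' where "p = b # p'" using f0 by (cases p) auto
    with p fh[of b p'] show ?thesis by auto
  qed
  have hd_in: "[b] \<in> vertices s" if "b # p \<in> vertices s" for b p
    using vertices_appendD[of "[b]" p s] that by simp
  define g where "g = (if child True s \<noteq> Leaf then (if d True then id else Not)
     else if child False s \<noteq> Leaf then (if d False then Not else id) else id)"
  have "bij Not" by (rule o_bij[of Not]) auto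
  then have "bij g" by (simp add: g_def)
  have gd: "g b = d b" if "child b s \<noteq> Leaf" for b
    using that dinj[of True False]
    by (cases b) (auto simp: g_def pres)
  have iff: "child b s = Leaf \<longleftrightarrow> child (g b) t = Leaf" for b
  proof
    assume b: "child b s = Leaf"
    show "child (g b) t = Leaf"
    proof (rule ccontr)
      assume "child (g b) t \<noteq> Leaf"
      then have "[g b] \<in> vertices t" by (simp add: prest)
      then obtain b' p where b': "b' # p \<in> vertices s" "d b' = g b" using dsurj by blast
      then have "child b' s \<noteq> Leaf" using hd_in pres by blast
      with b' have "g b' = g b" by (simp add: gd)
      then have "b' = b" using \<open>bij g\<close> by (simp add: bij_is_inj inj_eq)
      with \<open>child b' s \<noteq> Leaf\<close> b show False by simp
    qed
  next
    assume "child (g b) t = Leaf"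
    then show "child b s = Leaf" using dim[of b] gd[of b]
      by (cases "child b s = Leaf") (auto simp: pres prest)
  qed
  have "rooted_iso (h b) (child b s) (child (g b) t)" if b: "child b s \<noteq> Leaf" for b
    unfolding rooted_iso_def
  proof (intro conjI ballI)
    have inS: "p \<in> vertices (child b s) \<longleftrightarrow> b # p \<in> vertices s" for p
      by (simp add: Cons_in_vertices)
    show "h b [] = []" using b by (simp add: h_def d1 pres)
    show "bij_betw (h b) (vertices (child b s)) (vertices (child (g b) t))"
      unfolding bij_betw_def
    proof (intro conjI inj_onI equalityI subsetI)
      fix p q assume "p \<in> vertices (child b s)" "q \<in> vertices (child b s)" "h b p = h b q"
      then show "p = q" using inj_onD[OF inj, of "b # p" "b # q"] by (simp add: inS fh)
    next
      fix q assume "q \<in> h b ` vertices (child b s)"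
      then obtain p where p: "b # p \<in> vertices s" "q = h b p" by (auto simp: inS)
      then have "d b # q \<in> vertices t" using img imageI[OF p(1), of f] by (simp add: fh)
      then show "q \<in> vertices (child (g b) t)" using b by (simp add: Cons_in_vertices gd)
    next
      fix q assume "q \<in> vertices (child (g b) t)"
      then have "d b # q \<in> vertices t" using b by (simp add: Cons_in_vertices gd)
      then obtain b' p where *: "b' # p \<in> vertices s" "d b' = d b" "h b' p = q"
        using dsurj by blast
      then have "b' = b" using dinj[of b' b] hd_in[of b' p] b by (simp add: pres)
      with * have "p \<in> vertices (child b s)" "q = h b p" by (simp_all add: inS)
      then show "q \<in> h b ` vertices (child b s)" by blast
    qed
    fix p q assume "p \<in> vertices (child b s)" "q \<in> vertices (child b s)"
    then show "(\<exists>b. q = p @ [b]) \<longleftrightarrow> (\<exists>c. h b q = h b p @ [c])"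
      using edge[of "b # p" "b # q"] by (simp add: inS fh)
  qed
  with \<open>bij g\<close> iff show ?thesis by blast
qed

lemma rooted_iso_Node:
  assumes g: "bij g" and ne: "s \<noteq> Leaf" "t \<noteq> Leaf"
    and iff: "\<And>b. child b s = Leaf \<longleftrightarrow> child (g b) t = Leaf"
    and h: "\<And>b. child b s \<noteq> Leaf \<Longrightarrow> rooted_iso (h b) (child b s) (child (g b) t)"
  shows "rooted_iso (\<lambda>p. case p of [] \<Rightarrow> [] | b # q \<Rightarrow> g b # h b q) s t"
    (is "rooted_iso ?f s t")
proof -
  have h': "rooted_iso (h b) (child b s) (child (g b) t)" if "q \<in> vertices (child b s)" for b q
    using h[of b] that by (cases "child b s = Leaf") auto
  have himg: "h b ` vertices (child b s) = vertices (child (g b) t)" for b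
    using h[of b] iff[of b]
    by (cases "child b s = Leaf") (auto simp: rooted_iso_def bij_betw_def)
  have hinj: "inj_on (h b) (vertices (child b s))" for b
    using h[of b] by (cases "child b s = Leaf") (auto simp: rooted_iso_def bij_betw_def)
  have h0: "h b q = [] \<longleftrightarrow> q = []" if "q \<in> vertices (child b s)" for b q
  proof -
    have "[] \<in> vertices (child b s)" using that vertices_appendD[of "[]" q] by simp
    moreover have "h b [] = []" using h'[OF that] by (simp add: rooted_iso_def)
    ultimately show ?thesis using hinj[of b] that by (metis inj_onD)
  qed
  have ginj: "g b = g c \<longleftrightarrow> b = c" for b c using g by (simp add: bij_is_inj inj_eq)
  show ?thesis unfolding rooted_iso_def
  proof (intro conjI ballI)
    show "?f [] = []" by simp
    show "bij_betw ?f (vertices s) (vertices t)"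
      unfolding bij_betw_def
    proof (intro conjI inj_onI equalityI subsetI)
      fix p q assume "p \<in> vertices s" "q \<in> vertices s" "?f p = ?f q"
      then show "p = q" using hinj
        by (auto split: list.splits simp: ginj Cons_in_vertices dest: inj_onD)
    next
      fix q assume "q \<in> ?f ` vertices s"
      then obtain p where "p \<in> vertices s" "q = ?f p" by blast
      then show "q \<in> vertices t" using ne himg
        by (auto split: list.splits simp: Nil_in_vertices Cons_in_vertices)
    next
      fix q assume q: "q \<in> vertices t"
      show "q \<in> ?f ` vertices s"
      proof (cases q)
        case Nil
        then show ?thesis using ne by (auto simp: image_iff Nil_in_vertices intro!: bexI[of _ "[]"])
      next
        case (Cons c r)
        obtain b where b: "c = g b" using bij_is_surj[OF g] by (auto elim: surjE)
        have "r \<in> h b ` vertices (child b s)" using q by (simp add: himg Cons Cons_in_vertices b)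
        then obtain p where "p \<in> vertices (child b s)" "r = h b p" by blast
        then show ?thesis
          by (auto simp: image_iff Cons b Cons_in_vertices intro!: bexI[of _ "b # p"])
      qed
    qed
    fix p q assume p: "p \<in> vertices s" and q: "q \<in> vertices s"
    show "(\<exists>b. q = p @ [b]) \<longleftrightarrow> (\<exists>c. ?f q = ?f p @ [c])"
    proof (cases p)
      case Nil
      then show ?thesis using q by (cases q) (auto simp: Cons_in_vertices h0)
    next
      case p': (Cons b p')
      show ?thesis
      proof (cases q)
        case q': (Cons c q')
        show ?thesis
        proof (cases "b = c")
          case True
          have "p' \<in> vertices (child b s)" "q' \<in> vertices (child b s)"
            using p q p' q' True by (auto simp: Cons_in_vertices)
          then show ?thesis using h'[of p' b] p' q' True by (simp add: rooted_iso_def)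
        qed (use p' q' ginj in auto)
      qed (use p' in auto)
    qed
  qed
qed

lemma unordered_eq_iff_rooted_iso:
  assumes "s \<noteq> Leaf" "t \<noteq> Leaf"
  shows "unordered s = unordered t \<longleftrightarrow> (\<exists>f. rooted_iso f s t)"
  using assms
proof (induction "size s" arbitrary: s t rule: less_induct)
  case less
  have IH: "unordered (child b s) = unordered (child c t) \<longleftrightarrow>
      (\<exists>f. rooted_iso f (child b s) (child c t))"
    if "child b s \<noteq> Leaf" "child c t \<noteq> Leaf" for b c
    using less.hyps[OF size_child that] less.prems by blast
  show ?case
  proof
    assume "unordered s = unordered t"
    then obtain g where g: "bij g" "\<And>b. child b s = Leaf \<longleftrightarrow> child (g b) t = Leaf"
      "\<And>b. child b s \<noteq> Leaf \<Longrightarrow> unordered (child b s) = unordered (child (g b) t)"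
      using unordered_eq_iff[OF less.prems] by blast
    have "\<forall>b. \<exists>f. child b s \<noteq> Leaf \<longrightarrow> rooted_iso f (child b s) (child (g b) t)"
      using g IH by metis
    then obtain h where "\<And>b. child b s \<noteq> Leaf \<Longrightarrow> rooted_iso (h b) (child b s) (child (g b) t)"
      by metis
    then show "\<exists>f. rooted_iso f s t"
      using rooted_iso_Node[OF g(1) less.prems g(2)] by blast
  next
    assume "\<exists>f. rooted_iso f s t"
    then obtain g h where g: "bij g" "\<And>b. child b s = Leaf \<longleftrightarrow> child (g b) t = Leaf"
      "\<And>b. child b s \<noteq> Leaf \<Longrightarrow> rooted_iso (h b) (child b s) (child (g b) t)"
      using rooted_iso_child less.prems by metis
    have "child b s \<noteq> Leaf \<Longrightarrow> unordered (child b s) = unordered (child (g b) t)" for b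
      using g IH by metis
    with g show "unordered s = unordered t"
      unfolding unordered_eq_iff[OF less.prems] by blast
  qed
qed

end

theory Submission
  imports Defs "HOL-Real_Asymp.Real_Asymp"
begin

text \<open>
  Write $P(T)$ for the total weight $4^{-|t|}$ of the binary trees $t$ of shape $T$. A sum of a toll
  $f$ over the fringe subtrees of a random tree of size $n$ concentrates at $(n+1)\varphi$ with
  $\varphi = \sum_t f(t) 4^{-|t|}$, because generating functions bound the second moment by
  $n(n+1)\varphi^2$ plus the contribution of nested pairs. Hence there are about
  $2n/\sqrt{\pi k}$ fringe subtrees of size greater than $k$.

  Upper bound: there are $O(\beta^k)$ shapes of size at most $k$, and all larger fringe subtrees are
  counted separately, with $k$ slightly below $\log n/\log\beta$.

  Lower bound: a shape of a tree $t$ with $s$ symmetric nodes (both subtrees of equal shape, leaves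
  included) is represented by $2^{|t|-s}$ binary trees, and $s$ concentrates at $\mu|t|$ with
  $\mu = \frac14\sum_T P(T)^2$. So typically $P(T) \approx 2^{-(1+\mu)|T|}$, and among the
  fringe subtrees of size just above $\log n/((1+\mu)\log 2)$ and beyond almost no shape occurs twice.

  Both rounded constants leave some room to the true ones, so the error terms can be taken to be zero.
\<close>

unbundle no vec_syntax
unbundle fps_syntax

section \<open>Generating functions of sums over fringe subtrees\<close>

text \<open>Put T(x) = (1 - x)^(-1/2), with coefficients binomial(2n, n) / 4^n. Summing a toll over
  all fringe subtrees multiplies its generating function by T, so exact coefficients, their
  monotonicity and Wallis' product replace singularity analysis. The concentration bound costs the
  largest size in the support of the toll. Hence large fringe subtrees are counted as the complement
  of the small ones (upper bound) or inside a window k < size \<le> k^2 with k of order log n (lower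
  bound); cutting at k^2 loses only O(n / log n) of them. For the same reason symmetric nodes are
  counted only in trees of bounded height, which suffices because the inequality to be met is
  strict. With k = log n / \<kappa> the count 2n / sqrt(pi k) gives the constant 2 sqrt(\<kappa> /
  pi), where \<kappa> is close to (1 + \<mu>) ln 2 below and to ln \<beta> above. Both \<beta> and
  \<mu> come from functional equations that involve a series of the same kind at x^2. The numerical
  bounds therefore run backwards along x, x^2, x^4, ... from a power so small that a crude estimate
  is enough.\<close>

fun fringe_sum :: "('a tree \<Rightarrow> real) \<Rightarrow> 'a tree \<Rightarrow> real" where
  "fringe_sum f Leaf = 0"
| "fringe_sum f (Node l x r) = f (Node l x r) + fringe_sum f l + fringe_sum f r"

text \<open>Dividing by \<open>4 ^ n\<close> moves the singularity of the Catalan series to 1; the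
  sum of the coefficients up to n is then the part of \<phi> that comes from trees of size at most
  n.\<close>

definition tree_gf :: "(unit tree \<Rightarrow> real) \<Rightarrow> real fps" where
  "tree_gf h = Abs_fps (\<lambda>n. (\<Sum>t\<in>binary_trees n. h t) / 4 ^ n)"

definition catalan_gf :: "real fps" where
  "catalan_gf = tree_gf (\<lambda>_. 1)"

text \<open>This is binomial(2n, n) / 4^n. The product form gives a one-step recurrence and is close
  to Wallis' product.\<close>

definition central :: "nat \<Rightarrow> real" where
  "central n = (\<Prod>k=1..n. (2 * real k - 1) / (2 * real k))"

definition central_gf :: "real fps" where
  "central_gf = Abs_fps central"

lemma sum_binary_trees_Suc:
  fixes h :: "unit tree \<Rightarrow> 'b::comm_monoid_add"
  shows "(\<Sum>t\<in>binary_trees (Suc n). h t) =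
    (\<Sum>k\<le>n. \<Sum>l\<in>binary_trees k. \<Sum>r\<in>binary_trees (n - k). h (Node l () r))"
proof -
  have "(\<Sum>t\<in>binary_trees (Suc n). h t) =
      (\<Sum>k\<le>n. \<Sum>t\<in>(\<lambda>(l, r). Node l () r) ` (binary_trees k \<times> binary_trees (n - k)). h t)"
    unfolding binary_trees_Suc
  proof (rule sum.UNION_disjoint)
    show "\<forall>k\<in>{..n}. finite ((\<lambda>(l, r). Node l () r) ` (binary_trees k \<times> binary_trees (n - k)))"
      by (simp add: finite_binary_trees)
  qed (auto simp: binary_trees_def)
  also have "\<dots> = (\<Sum>k\<le>n. \<Sum>(l, r)\<in>binary_trees k \<times> binary_trees (n - k). h (Node l () r))"
    by (intro sum.cong refl, subst sum.reindex) (auto simp: inj_on_def case_prod_unfold)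
  finally show ?thesis by (simp add: sum.cartesian_product)
qed

lemma tree_gf_nth: "tree_gf h $ n = (\<Sum>t\<in>binary_trees n. h t) / 4 ^ n"
  by (simp add: tree_gf_def)

lemma tree_gf_add: "tree_gf (\<lambda>t. f t + g t) = tree_gf f + tree_gf g"
  by (rule fps_ext) (simp add: tree_gf_nth sum.distrib add_divide_distrib)

lemma tree_gf_cmult: "tree_gf (\<lambda>t. c * f t) = fps_const c * tree_gf f"
  by (rule fps_ext) (simp add: tree_gf_nth sum_distrib_left)

text \<open>A weight that factorises over the two subtrees turns the decomposition at the root into
  a Cauchy product; the root itself contributes \<open>fps_X\<close> and a factor 1/4.\<close>

lemma tree_gf_Node:
  assumes "\<And>l r. h (Node l () r) = f l * g r"
  shows "tree_gf h = fps_const (h Leaf) + fps_const (1/4) * fps_X * (tree_gf f * tree_gf g)"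
proof (rule fps_ext)
  fix n
  show "tree_gf h $ n = (fps_const (h Leaf) + fps_const (1/4) * fps_X * (tree_gf f * tree_gf g)) $ n"
  proof (cases n)
    case 0
    then show ?thesis by (simp add: tree_gf_nth binary_trees_0 mult.assoc)
  next
    case (Suc m)
    have "tree_gf h $ Suc m = (\<Sum>k\<le>m. (\<Sum>l\<in>binary_trees k. f l) * (\<Sum>r\<in>binary_trees (m - k). g r)) / 4 ^ Suc m"
      by (simp add: tree_gf_nth sum_binary_trees_Suc assms sum_product)
    also have "\<dots> = (\<Sum>k\<le>m. (\<Sum>l\<in>binary_trees k. f l) * (\<Sum>r\<in>binary_trees (m - k). g r) / 4 ^ Suc m)"
      by (rule sum_divide_distrib)
    also have "\<dots> = (\<Sum>k\<le>m. (1/4) * (tree_gf f $ k * tree_gf g $ (m - k)))"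
      by (intro sum.cong refl) (simp add: tree_gf_nth power_add[symmetric])
    also have "\<dots> = (fps_const (1/4) * fps_X * (tree_gf f * tree_gf g)) $ Suc m"
      by (simp add: mult.assoc fps_mult_nth[of "tree_gf f" "tree_gf g"] sum_distrib_left atLeast0AtMost)
    finally show ?thesis by (simp add: Suc)
  qed
qed

lemma tree_gf_nonneg: "(\<And>t. h t \<ge> 0) \<Longrightarrow> tree_gf h $ n \<ge> 0"
  by (simp add: tree_gf_nth sum_nonneg)

section \<open>Central binomial coefficients and the Catalan series\<close>

lemma central_0 [simp]: "central 0 = 1"
  by (simp add: central_def)

lemma central_Suc: "central (Suc n) = central n * (2 * real n + 1) / (2 * real n + 2)"
  by (simp add: central_def algebra_simps)

lemma central_pos: "central n > 0"
  by (induction n) (auto simp: central_Suc)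

lemma catalan_gf_eq: "catalan_gf = 1 + fps_const (1/4) * fps_X * (catalan_gf * catalan_gf)"
  unfolding catalan_gf_def by (subst tree_gf_Node[where f="\<lambda>_. 1" and g="\<lambda>_. 1"]) auto

text \<open>Write C for \<open>catalan_gf\<close> and D = 1 - xC/2. The quadratic equation for C
  says exactly D^2 = 1 - x, so D is the square root of 1 - x and its inverse is T.\<close>

lemma central_gf_mult_catalan: "central_gf * (1 - fps_const (1/2) * fps_X * catalan_gf) = 1"
  and central_gf_square: "central_gf * central_gf * (1 - fps_X) = 1"
proof -
  define D where "D = 1 - fps_const (1/2) * fps_X * catalan_gf"
  define T where "T = inverse D"
  have D0: "D $ 0 = 1" by (simp add: D_def mult.assoc)
  have TD: "T * D = 1" unfolding T_def by (rule inverse_mult_eq_1) (simp add: D0)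
  have const: "fps_const 2 = (2::real fps)"
    by (simp flip: numeral_fps_const)
  have D2: "D * D = 1 - fps_X"
  proof -
    define h :: "real fps" where "h = fps_const (1/2)"
    have h: "h + h = 1" "h * h = fps_const (1/4)" by (simp_all add: h_def)
    have "D * D = 1 - (h + h) * fps_X * catalan_gf
       + fps_X * ((h * h) * fps_X * (catalan_gf * catalan_gf))"
      by (simp add: D_def h_def[symmetric] algebra_simps)
    also have "\<dots> = 1 - fps_X * catalan_gf + fps_X * (fps_const (1/4) * fps_X * (catalan_gf * catalan_gf))"
      unfolding h by simp
    also have "fps_const (1/4) * fps_X * (catalan_gf * catalan_gf) = catalan_gf - 1"
      using catalan_gf_eq by (simp add: algebra_simps)
    finally show ?thesis by (simp add: algebra_simps)
  qed
  have DD': "2 * D * fps_deriv D = -1"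
    using arg_cong[OF D2, of fps_deriv] by (simp add: algebra_simps)
  have TD': "fps_deriv T * D + T * fps_deriv D = 0"
    using arg_cong[OF TD, of fps_deriv] by (simp add: algebra_simps)
  \<comment> \<open>The differential equation of (1 - x)^(-1/2). Comparing coefficients gives the
    recurrence of \<open>central\<close>.\<close>
  have eq: "2 * (1 - fps_X) * fps_deriv T = T"
  proof -
    have "0 = 2 * D * (fps_deriv T * D + T * fps_deriv D)" by (simp add: TD')
    also have "\<dots> = 2 * (D * D) * fps_deriv T + T * (2 * D * fps_deriv D)" by (simp add: algebra_simps)
    also have "\<dots> = 2 * (1 - fps_X) * fps_deriv T - T" by (simp add: D2 DD')
    finally show ?thesis by simp
  qed
  have rec: "T $ Suc n * (2 * real n + 2) = T $ n * (2 * real n + 1)" for n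
  proof -
    have e: "2 * (1 - fps_X) * fps_deriv T = fps_const 2 * (fps_deriv T - fps_X * fps_deriv T)"
      by (simp add: algebra_simps const)
    have "2 * (real (Suc n) * T $ Suc n - real n * T $ n) = T $ n"
      using arg_cong[OF eq, of "\<lambda>f. f $ n"] unfolding e
      by (cases n) (simp_all add: algebra_simps)
    then show ?thesis by (simp add: algebra_simps)
  qed
  have T: "T = central_gf"
  proof (rule fps_ext)
    fix n show "T $ n = central_gf $ n"
    proof (induction n)
      case 0 then show ?case by (simp add: central_gf_def T_def D0)
    next
      case (Suc n)
      then show ?case using rec[of n] by (simp add: central_gf_def central_Suc field_simps)
    qed
  qed
  show "central_gf * (1 - fps_const (1/2) * fps_X * catalan_gf) = 1"
    using TD by (simp add: T D_def)
  have "central_gf * central_gf * (1 - fps_X) = (T * D) * (T * D)" unfolding T D2[symmetric] by (simp only: mult_ac)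
  then show "central_gf * central_gf * (1 - fps_X) = 1" by (simp add: TD)
qed

text \<open>Both identities above together give T (1 - x) = 1 - xC/2. Written as a difference, the
  coefficients telescope when summed over a range of sizes.\<close>

lemma catalan_gf_nth: "catalan_gf $ n = 2 * (central n - central (Suc n))"
proof -
  have "central_gf * (1 - fps_X) = central_gf * (1 - fps_X) * (central_gf * (1 - fps_const (1/2) * fps_X * catalan_gf))"
    unfolding central_gf_mult_catalan by simp
  also have "\<dots> = (central_gf * central_gf * (1 - fps_X)) * (1 - fps_const (1/2) * fps_X * catalan_gf)"
    by (simp only: mult_ac)
  finally have "central_gf * (1 - fps_X) = 1 - fps_const (1/2) * (fps_X * catalan_gf)"
    unfolding central_gf_square by (simp add: mult.assoc)
  from arg_cong[OF this, of "\<lambda>f. f $ Suc n"] show ?thesis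
    by (simp add: right_diff_distrib mult.assoc central_gf_def)
qed

lemma catalan_gf_nth': "catalan_gf $ n = central n / (real n + 1)"
  by (simp add: catalan_gf_nth central_Suc field_simps)

lemma sum_catalan_gf: "(\<Sum>j\<in>{m<..n}. catalan_gf $ j) = 2 * (central (Suc m) - central (Suc n))" if "m \<le> n"
  using that by (induction rule: dec_induct) (simp_all add: catalan_gf_nth atLeastSucAtMost_greaterThanAtMost[symmetric] atLeastAtMostSuc_conv)

text \<open>Splitting off the root, F = \<open>tree_gf (fringe_sum f)\<close> solves the linear
  equation F = f + (x/2) C F, and T is the inverse of 1 - (x/2) C.\<close>

lemma tree_gf_fringe_sum:
  assumes "f Leaf = 0"
  shows "tree_gf (fringe_sum f) = central_gf * tree_gf f"
proof -
  let ?F = "tree_gf (fringe_sum f)"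
  define hl where "hl t = (case t of Leaf \<Rightarrow> 0 | Node l x r \<Rightarrow> fringe_sum f l * 1)" for t :: "unit tree"
  define hr where "hr t = (case t of Leaf \<Rightarrow> 0 | Node l x r \<Rightarrow> 1 * fringe_sum f r)" for t :: "unit tree"
  have "fringe_sum f = (\<lambda>t. f t + (hl t + hr t))"
    by (rule ext, case_tac t) (auto simp: hl_def hr_def assms)
  then have "?F = tree_gf f + (tree_gf hl + tree_gf hr)"
    by (metis tree_gf_add)
  also have "tree_gf hl = fps_const (1/4) * fps_X * (?F * catalan_gf)"
    unfolding catalan_gf_def by (subst tree_gf_Node[where f="fringe_sum f" and g="\<lambda>_. 1"]) (auto simp: hl_def)
  also have "tree_gf hr = fps_const (1/4) * fps_X * (catalan_gf * ?F)"
    unfolding catalan_gf_def by (subst tree_gf_Node[where g="fringe_sum f" and f="\<lambda>_. 1"]) (auto simp: hr_def)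
  also have "fps_const (1/4) * fps_X * (?F * catalan_gf) + fps_const (1/4) * fps_X * (catalan_gf * ?F)
     = (fps_const (1/4) + fps_const (1/4)) * fps_X * catalan_gf * ?F"
    by (simp only: distrib_left distrib_right mult_ac)
  also have "fps_const (1/4) + fps_const (1/4) = (fps_const (1/2) :: real fps)" by simp
  finally have "?F = tree_gf f + fps_const (1/2) * fps_X * catalan_gf * ?F" .
  then have eq: "(1 - fps_const (1/2) * fps_X * catalan_gf) * ?F = tree_gf f"
    by (simp add: algebra_simps)
  have "?F = central_gf * ((1 - fps_const (1/2) * fps_X * catalan_gf) * ?F)"
    by (simp add: mult.assoc[symmetric] central_gf_mult_catalan)
  then show ?thesis by (simp add: eq)
qed

text \<open>Ordered pairs of vertices are sorted by position: nested or equal pairs are collected at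
  the upper vertex, where they contribute f (2F - f), and disjoint pairs at the vertex where they
  branch.\<close>

lemma fringe_sum_square:
  fixes f :: "'a tree \<Rightarrow> real"
  assumes "f Leaf = 0"
  shows "(fringe_sum f t)\<^sup>2 = fringe_sum (\<lambda>t. f t * (2 * fringe_sum f t - f t)) t
     + 2 * fringe_sum (\<lambda>t. case t of Leaf \<Rightarrow> 0 | Node l x r \<Rightarrow> fringe_sum f l * fringe_sum f r) t"
  by (induction t) (simp_all add: algebra_simps power2_eq_square)

lemma cauchy_product_le:
  fixes u :: "real fps"
  assumes "\<And>n. u $ n \<ge> 0"
  shows "(\<Sum>i\<le>n. (u * u) $ i) \<le> (\<Sum>i\<le>n. u $ i)\<^sup>2"
proof -
  have "(\<Sum>i\<le>n. (u * u) $ i) = (\<Sum>i\<le>n. \<Sum>j\<le>i. u $ j * u $ (i - j))"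
    by (simp add: fps_mult_nth atLeast0AtMost)
  also have "\<dots> = (\<Sum>(i,j)\<in>{(i,j). i + j \<le> n}. u $ i * u $ j)"
    by (rule sum.triangle_reindex_eq[symmetric])
  also have "\<dots> \<le> (\<Sum>(i,j)\<in>{..n} \<times> {..n}. u $ i * u $ j)"
    by (rule sum_mono2) (auto simp: assms)
  also have "\<dots> = (\<Sum>i\<le>n. u $ i)\<^sup>2"
    by (simp add: power2_eq_square sum_product sum.cartesian_product)
  finally show ?thesis .
qed

text \<open>
  The kernel of the second moment is $\frac{x}{2} T(x)^3$ with $T$ = \<^const>\<open>central_gf\<close>; its
  coefficients $n a_n$ increase, so all shifts are bounded by the last one.
\<close>

lemma tree_gf_fringe_sum_square_le:
  assumes "f Leaf = 0" "\<And>t. f t \<ge> 0"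
  shows "tree_gf (\<lambda>t. (fringe_sum f t)\<^sup>2) $ n \<le>
    tree_gf (fringe_sum (\<lambda>t. f t * (2 * fringe_sum f t - f t))) $ n
     + real n * central n * (\<Sum>i\<le>n. tree_gf f $ i)\<^sup>2"
proof -
  define g where "g t = (case t of Leaf \<Rightarrow> 0 | Node l x r \<Rightarrow> fringe_sum f l * fringe_sum f r)" for t :: "unit tree"
  define u where "u = tree_gf f"
  have u0: "u $ n \<ge> 0" for n unfolding u_def by (intro tree_gf_nonneg assms)
  define Q where "Q = fps_const (1/2) * fps_X * (central_gf * central_gf * central_gf)"
  have "tree_gf g = fps_const (1/4) * fps_X * (tree_gf (fringe_sum f) * tree_gf (fringe_sum f))"
    by (subst tree_gf_Node[where f="fringe_sum f" and g="fringe_sum f"]) (auto simp: g_def)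
  also have "tree_gf (fringe_sum f) = central_gf * u"
    by (simp add: tree_gf_fringe_sum assms(1) u_def)
  also have "fps_const (1/4) * fps_X * (central_gf * u * (central_gf * u)) =
      fps_const (1/4) * fps_X * (central_gf * central_gf) * (u * u)"
    by (simp only: mult_ac)
  finally have g: "tree_gf g = fps_const (1/4) * fps_X * (central_gf * central_gf) * (u * u)" .
  have "fps_const 2 * tree_gf (fringe_sum g) = fps_const 2 * (central_gf * tree_gf g)"
    by (simp add: tree_gf_fringe_sum g_def)
  also have "\<dots> = (fps_const 2 * fps_const (1/4)) * fps_X * (central_gf * central_gf * central_gf) * (u * u)"
    by (simp only: g mult_ac)
  finally have g2: "fps_const 2 * tree_gf (fringe_sum g) = (u * u) * Q" unfolding Q_def by (simp only: mult_ac fps_const_mult) simp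
  \<comment> \<open>Since T^2 (1 - x) = 1, the cube in Q collapses: the coefficients of Q are the
    partial sums of T/2, which have the closed form n times \<open>central n\<close>.\<close>
  have "Q * (1 - fps_X) = fps_const (1/2) * fps_X * central_gf * (central_gf * central_gf * (1 - fps_X))"
    by (simp only: Q_def mult_ac)
  also have "\<dots> = fps_const (1/2) * fps_X * central_gf"
    by (simp only: central_gf_square mult_1_right)
  finally have Qeq: "Q * (1 - fps_X) = fps_const (1/2) * (fps_X * central_gf)"
    by (simp only: mult.assoc)
  have Q: "Q $ n = real n * central n" for n
  proof (induction n)
    case 0 then show ?case by (simp add: Q_def mult.assoc)
  next
    case (Suc n)
    have "Q $ Suc n = Q $ n + central n / 2"
      using arg_cong[OF Qeq, of "\<lambda>f. f $ Suc n"] by (simp add: algebra_simps central_gf_def)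
    then show ?case by (simp add: Suc central_Suc field_simps)
  qed
  have Qmono: "Q $ i \<le> Q $ n" if "i \<le> n" for i n using that
  proof (induction rule: dec_induct)
    case (step m)
    have "real m * central m \<le> real (Suc m) * central (Suc m)" using central_pos[of m] by (simp add: central_Suc field_simps)
    then show ?case using step by (simp add: Q)
  qed simp
  have uu: "(u * u) $ i \<ge> 0" for i using u0 by (simp add: fps_mult_nth sum_nonneg)
  have "((u * u) * Q) $ n = (\<Sum>i\<le>n. (u * u) $ i * Q $ (n - i))" by (simp add: fps_mult_nth[of "u*u"] atLeast0AtMost)
  also have "\<dots> \<le> (\<Sum>i\<le>n. (u * u) $ i * Q $ n)" by (intro sum_mono mult_left_mono Qmono uu) auto
  also have "\<dots> = (\<Sum>i\<le>n. (u * u) $ i) * Q $ n" by (simp add: sum_distrib_right)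
  also have "\<dots> \<le> (\<Sum>i\<le>n. u $ i)\<^sup>2 * Q $ n"
    by (intro mult_right_mono cauchy_product_le u0) (simp add: Q central_pos less_imp_le)
  finally have le: "((u * u) * Q) $ n \<le> real n * central n * (\<Sum>i\<le>n. u $ i)\<^sup>2" by (simp add: Q mult.commute)
  have "tree_gf (\<lambda>t. (fringe_sum f t)\<^sup>2) = tree_gf (\<lambda>t. fringe_sum (\<lambda>t. f t * (2 * fringe_sum f t - f t)) t + 2 * fringe_sum g t)"
    unfolding g_def using fringe_sum_square[of f, OF assms(1)] by presburger
  also have "\<dots> = tree_gf (fringe_sum (\<lambda>t. f t * (2 * fringe_sum f t - f t))) + fps_const 2 * tree_gf (fringe_sum g)"
    by (simp only: tree_gf_add tree_gf_cmult)
  finally have "tree_gf (\<lambda>t. (fringe_sum f t)\<^sup>2) $ n =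
      tree_gf (fringe_sum (\<lambda>t. f t * (2 * fringe_sum f t - f t))) $ n + (u * u * Q) $ n"
    by (simp only: g2 fps_add_nth)
  then show ?thesis using le unfolding u_def by linarith
qed

section \<open>Moments and concentration\<close>

abbreviation expect :: "nat \<Rightarrow> (unit tree \<Rightarrow> real) \<Rightarrow> real" where
  "expect n \<equiv> measure_pmf.expectation (random_binary_tree n)"

lemma expect_eq_sum: "expect n h = (\<Sum>t\<in>binary_trees n. h t) / card (binary_trees n)"
  unfolding random_binary_tree_def
  by (rule integral_pmf_of_set) (simp_all add: binary_trees_nonempty finite_binary_trees)

lemma expect_eq: "expect n h = tree_gf h $ n * (real n + 1) / central n"
proof -
  have "catalan_gf $ n = card (binary_trees n) / 4 ^ n"
    by (simp add: catalan_gf_def tree_gf_nth)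
  then have "card (binary_trees n) = 4 ^ n * (central n / (real n + 1))"
    by (simp add: catalan_gf_nth' field_simps)
  then show ?thesis using central_pos[of n] by (simp add: expect_eq_sum tree_gf_nth)
qed

lemma set_random_binary_tree: "set_pmf (random_binary_tree n) = binary_trees n"
  by (simp add: random_binary_tree_def binary_trees_nonempty finite_binary_trees set_pmf_of_set)

lemma integrable_tree: "integrable (measure_pmf (random_binary_tree n)) (h :: unit tree \<Rightarrow> real)"
  by (rule integrable_measure_pmf_finite) (simp add: set_random_binary_tree finite_binary_trees)

lemma expect_mono: "(\<And>t. size t = n \<Longrightarrow> f t \<le> g t) \<Longrightarrow> expect n f \<le> expect n g"
  unfolding expect_eq_sum
  by (intro divide_right_mono sum_mono) (auto simp: binary_trees_def)

lemma expect_add: "expect n (\<lambda>t. f t + g t) = expect n f + expect n g"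
  by (simp add: expect_eq_sum sum.distrib add_divide_distrib)

lemma expect_diff: "expect n (\<lambda>t. f t - g t) = expect n f - expect n g"
  by (simp add: expect_eq_sum sum_subtractf diff_divide_distrib)

lemma expect_cmult: "expect n (\<lambda>t. c * f t) = c * expect n f"
  by (simp add: expect_eq_sum sum_distrib_left)

lemma expect_sum: "expect n (\<lambda>t. \<Sum>i\<in>I. f i t) = (\<Sum>i\<in>I. expect n (f i))"
  by (simp add: expect_eq_sum sum_divide_distrib[symmetric] sum.swap[of _ I])

lemma expect_const: "expect n (\<lambda>_. c) = c"
  by simp

lemma prob_tree_markov:
  assumes "\<And>t. h t \<ge> 0" "c > 0"
  shows "measure_pmf.prob (random_binary_tree n) {t. h t \<ge> c} \<le> expect n h / c"
  using integral_Markov_inequality_measure[OF integrable_tree[of n h], of UNIV c] assms by simp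

section \<open>Elementary properties of fringe sums, and their first two moments\<close>

lemma fringe_sum_mono: "(\<And>t. f t \<le> g t) \<Longrightarrow> fringe_sum f t \<le> fringe_sum g t"
  by (induction t) (auto intro!: add_mono)

lemma fringe_sum_add: "fringe_sum (\<lambda>t. f t + g t) t = fringe_sum f t + fringe_sum g t"
  by (induction t) auto

lemma fringe_sum_cmult: "fringe_sum (\<lambda>t. c * f t) t = c * fringe_sum f t"
  by (induction t) (auto simp: algebra_simps)

lemma fringe_sum_sum: "finite I \<Longrightarrow> fringe_sum (\<lambda>t. \<Sum>i\<in>I. f i t) t = (\<Sum>i\<in>I. fringe_sum (f i) t)"
  by (induction t) (auto simp: sum.distrib)

lemma fringe_sum_nonneg: "(\<And>t. f t \<ge> 0) \<Longrightarrow> fringe_sum f t \<ge> 0"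
  by (induction t) auto

lemma fringe_sum_le_size: "(\<And>t. f t \<le> 1) \<Longrightarrow> fringe_sum f t \<le> size t"
proof (induction t)
  case (Node l x r)
  then have "fringe_sum f l \<le> size l" "fringe_sum f r \<le> size r" "f (Node l x r) \<le> 1" by auto
  then show ?case by simp
qed simp

lemma fringe_sum_eq_0: "(\<And>s. size s \<le> size t \<Longrightarrow> s \<noteq> Leaf \<Longrightarrow> f s = 0) \<Longrightarrow> fringe_sum f t = 0"
proof (induction t)
  case (Node l x r)
  have "fringe_sum f l = 0" using Node.prems by (intro Node.IH) auto
  moreover have "fringe_sum f r = 0" using Node.prems by (intro Node.IH) auto
  moreover have "f (Node l x r) = 0" by (rule Node.prems) auto
  ultimately show ?case by simp
qed simp

lemma central_decseq: "i \<le> n \<Longrightarrow> central n \<le> central i"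
proof (induction rule: dec_induct)
  case (step m)
  have "central (Suc m) \<le> central m" using central_pos[of m] by (simp add: central_Suc field_simps)
  then show ?case using step by simp
qed simp

lemma mult_central_mono: "i \<le> n \<Longrightarrow> real i * central i \<le> real n * central n"
proof (induction rule: dec_induct)
  case (step m)
  have "real m * central m \<le> real (Suc m) * central (Suc m)"
    using central_pos[of m] by (simp add: central_Suc field_simps)
  then show ?case using step by linarith
qed simp

lemma expect_fringe_sum:
  assumes "f Leaf = 0"
  shows "expect n (fringe_sum f) = (real n + 1) * (\<Sum>i\<le>n. tree_gf f $ i * (central (n - i) / central n))"
proof -
  have "tree_gf (fringe_sum f) $ n = (\<Sum>i\<le>n. tree_gf f $ i * central (n - i))"
    unfolding tree_gf_fringe_sum[of f, OF assms] mult.commute[of central_gf]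
    by (simp add: fps_mult_nth[of "tree_gf f"] atLeast0AtMost) (simp add: central_gf_def)
  then show ?thesis by (simp add: expect_eq sum_divide_distrib[symmetric] mult.commute)
qed

text \<open>\<open>central\<close> decreases, so every ratio
  \<open>central (n - i) / central n\<close> is at least 1. This lower bound carries no error term,
  which makes (n + 1)\<phi> a good centre for the second moment.\<close>

lemma expect_fringe_sum_ge:
  assumes "f Leaf = 0" "\<And>t. f t \<ge> 0"
  shows "expect n (fringe_sum f) \<ge> (real n + 1) * (\<Sum>i\<le>n. tree_gf f $ i)"
proof -
  have "tree_gf f $ i * 1 \<le> tree_gf f $ i * (central (n - i) / central n)" for i
    using central_decseq[of "n - i" n] central_pos[of n] tree_gf_nonneg[OF assms(2)]
    by (intro mult_left_mono) auto
  then show ?thesis unfolding expect_fringe_sum[of f, OF assms(1)]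
    by (intro mult_left_mono sum_mono) auto
qed

text \<open>n times \<open>central n\<close> increases, so for i \<le> n/2 the ratio of central
  coefficients is at most n / (n - i) \<le> 2. The lost factor 2 is harmless, as the bound is
  applied to a toll of small total weight.\<close>

lemma expect_fringe_sum_le:
  assumes "f Leaf = 0" "\<And>t. f t \<ge> 0" "\<And>t. size t > m \<Longrightarrow> f t = 0" "2 * m \<le> n" "n > 0"
  shows "expect n (fringe_sum f) \<le> 2 * (real n + 1) * (\<Sum>i\<le>m. tree_gf f $ i)"
proof -
  have 0: "tree_gf f $ i = 0" if "i > m" for i
    using that assms(3) by (auto simp: tree_gf_nth binary_trees_def intro!: sum.neutral)
  have "tree_gf f $ i * (central (n - i) / central n) \<le> tree_gf f $ i * 2" if "i \<le> m" for i
  proof (intro mult_left_mono tree_gf_nonneg assms(2))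
    have "real n * central (n - i) \<le> 2 * (real (n - i) * central (n - i))"
      using that assms(4) central_pos[of "n-i"] by (auto simp: of_nat_diff)
    also have "\<dots> \<le> 2 * (real n * central n)"
      using mult_central_mono[of "n - i" n] by simp
    finally show "central (n - i) / central n \<le> 2"
      using assms(5) central_pos[of n] by (simp add: field_simps)
  qed
  then have "(\<Sum>i\<le>n. tree_gf f $ i * (central (n - i) / central n)) \<le> (\<Sum>i\<le>n. tree_gf f $ i * 2)"
    using 0 by (intro sum_mono) (metis mult_zero_left not_le order_refl)
  also have "\<dots> = (\<Sum>i\<le>m. tree_gf f $ i * 2)"
    using assms(4) 0 by (intro sum.mono_neutral_right) auto
  also have "\<dots> = 2 * (\<Sum>i\<le>m. tree_gf f $ i)" by (simp add: sum_distrib_left mult.commute)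
  finally have "(real n + 1) * (\<Sum>i\<le>n. tree_gf f $ i * (central (n - i) / central n))
      \<le> (real n + 1) * (2 * (\<Sum>i\<le>m. tree_gf f $ i))"
    by (intro mult_left_mono) auto
  then show ?thesis unfolding expect_fringe_sum[of f, OF assms(1)] by (simp only: mult_ac)
qed

lemma expect_fringe_sum_square_le:
  assumes "f Leaf = 0" "\<And>t. f t \<ge> 0"
  shows "expect n (\<lambda>t. (fringe_sum f t)\<^sup>2) \<le>
    expect n (fringe_sum (\<lambda>t. f t * (2 * fringe_sum f t - f t)))
     + real n * (real n + 1) * (\<Sum>i\<le>n. tree_gf f $ i)\<^sup>2"
  using mult_right_mono[OF tree_gf_fringe_sum_square_le[of f, OF assms], of "(real n + 1) / central n" n] central_pos[of n]
  unfolding expect_eq by (simp add: field_simps)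

text \<open>
  Centring at $(n+1)\varphi$ instead of the mean: the leading terms cancel and only the nested pairs
  contribute.
\<close>

lemma expect_fringe_sum_deviation:
  assumes "f Leaf = 0" "\<And>t. f t \<ge> 0" "\<And>t. f t \<le> 1" "\<And>t. size t > m \<Longrightarrow> f t = 0"
  defines "\<phi> n \<equiv> (\<Sum>i\<le>n. tree_gf f $ i)"
  shows "expect n (\<lambda>t. (fringe_sum f t - (real n + 1) * \<phi> n)\<^sup>2) \<le> 2 * real m * real n"
proof -
  let ?c = "(real n + 1) * \<phi> n"
  have phi: "\<phi> n \<ge> 0" unfolding \<phi>_def by (intro sum_nonneg tree_gf_nonneg assms)
  have toll: "f t * (2 * fringe_sum f t - f t) \<le> 2 * real m * f t" for t
  proof (cases "size t > m")
    case False
    then have "2 * fringe_sum f t - f t \<le> 2 * real m"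
      using fringe_sum_le_size[of f t] assms(2)[of t] assms(3) by (simp add: not_less)
    then have "f t * (2 * fringe_sum f t - f t) \<le> f t * (2 * real m)"
      by (intro mult_left_mono assms(2))
    then show ?thesis by (simp only: mult.commute[of "f t" "2 * real m"])
  qed (simp add: assms)
  have "fringe_sum (\<lambda>t. f t * (2 * fringe_sum f t - f t)) t \<le> 2 * real m * real n" if "size t = n" for t
  proof -
    have "fringe_sum (\<lambda>t. f t * (2 * fringe_sum f t - f t)) t \<le> 2 * real m * fringe_sum f t"
      using fringe_sum_mono[OF toll] by (simp add: fringe_sum_cmult)
    also have "\<dots> \<le> 2 * real m * real n"
      using fringe_sum_le_size[of f t] assms(3) that by (intro mult_left_mono) auto
    finally show ?thesis .
  qed
  then have "expect n (fringe_sum (\<lambda>t. f t * (2 * fringe_sum f t - f t))) \<le> 2 * real m * real n"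
    using expect_mono[of n _ "\<lambda>_. 2 * real m * real n"] by (simp add: expect_const)
  then have sq: "expect n (\<lambda>t. (fringe_sum f t)\<^sup>2) \<le> 2 * real m * real n + real n * (real n + 1) * (\<phi> n)\<^sup>2"
    using expect_fringe_sum_square_le[of f n, OF assms(1,2)] by (simp add: \<phi>_def)
  have "expect n (\<lambda>t. (fringe_sum f t - ?c)\<^sup>2) = expect n (\<lambda>t. (fringe_sum f t)\<^sup>2 + ((- 2 * ?c) * fringe_sum f t + ?c\<^sup>2))"
    by (rule arg_cong[of _ _ "expect n"], rule ext) (simp add: power2_eq_square algebra_simps)
  also have "\<dots> = expect n (\<lambda>t. (fringe_sum f t)\<^sup>2) + (- 2 * ?c) * expect n (fringe_sum f) + ?c\<^sup>2"
    by (simp only: expect_add expect_cmult expect_const)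
  also have "\<dots> \<le> (2 * real m * real n + real n * (real n + 1) * (\<phi> n)\<^sup>2) + (- 2 * ?c) * ?c + ?c\<^sup>2"
    using expect_fringe_sum_ge[of f n, OF assms(1,2)] phi
    by (intro add_mono sq mult_left_mono_neg) (auto simp: \<phi>_def)
  \<comment> \<open>The coefficients of \<phi>^2 add up to n(n + 1) - 2(n + 1)^2 + (n + 1)^2 = -(n +
    1).\<close>
  also have "\<dots> \<le> 2 * real m * real n"
    by (simp add: power2_eq_square algebra_simps)
  finally show ?thesis .
qed

text \<open>Chebyshev's inequality for the lower tail. This tail serves both directions, because the
  upper bound on the number of shapes subtracts a fringe sum.\<close>

lemma prob_fringe_sum_less:
  assumes "f Leaf = 0" "\<And>t. f t \<ge> 0" "\<And>t. f t \<le> 1" "\<And>t. size t > m \<Longrightarrow> f t = 0" "a > 0"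
  shows "measure_pmf.prob (random_binary_tree n) {t. fringe_sum f t \<le> (real n + 1) * (\<Sum>i\<le>n. tree_gf f $ i) - a}
     \<le> 2 * real m * real n / a\<^sup>2"
proof -
  let ?c = "(real n + 1) * (\<Sum>i\<le>n. tree_gf f $ i)"
  have "measure_pmf.prob (random_binary_tree n) {t. fringe_sum f t \<le> ?c - a}
     \<le> measure_pmf.prob (random_binary_tree n) {t. (fringe_sum f t - ?c)\<^sup>2 \<ge> a\<^sup>2}"
  proof (rule measure_pmf.finite_measure_mono, safe)
    fix t assume "fringe_sum f t \<le> ?c - a"
    then have "a\<^sup>2 \<le> (?c - fringe_sum f t)\<^sup>2" using assms(5) by (intro power_mono) auto
    then show "a\<^sup>2 \<le> (fringe_sum f t - ?c)\<^sup>2" by (simp add: power2_commute)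
  qed simp
  also have "\<dots> \<le> expect n (\<lambda>t. (fringe_sum f t - ?c)\<^sup>2) / a\<^sup>2"
    using assms(5) by (intro prob_tree_markov) auto
  also have "\<dots> \<le> 2 * real m * real n / a\<^sup>2"
    using expect_fringe_sum_deviation[of f m n] assms by (intro divide_right_mono) auto
  finally show ?thesis .
qed

text \<open>Two trees of the same size cannot be properly nested, so only the diagonal pairs
  remain.\<close>

lemma fringe_sum_same_size_square:
  assumes "\<And>t. t \<in> S \<Longrightarrow> size t = k" "k > 0"
  defines "f \<equiv> (\<lambda>t. of_bool (t \<in> S))"
  shows "f t * (2 * fringe_sum f t - f t) = f t"
proof (cases "t \<in> S")
  case True
  then obtain l x r where t: "t = Node l x r" using assms(1)[of t] assms(2) by (cases t) auto
  have "fringe_sum f l = 0" "fringe_sum f r = 0"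
    using assms(1)[OF True] assms(1) by (auto intro!: fringe_sum_eq_0 simp: f_def t)
  then show ?thesis using True by (simp add: t f_def)
qed (simp add: f_def)

text \<open>N^2 - N counts ordered pairs of distinct occurrences. The nested part of the second
  moment is exactly the mean of N, which leaves the squared weight of S.\<close>

lemma expect_same_size_pairs:
  assumes "\<And>t. t \<in> S \<Longrightarrow> size t = k" "k > 0"
  defines "f \<equiv> (\<lambda>t. of_bool (t \<in> S))"
  shows "expect n (\<lambda>t. (fringe_sum f t)\<^sup>2 - fringe_sum f t) \<le> real n * (real n + 1) * (card S / 4 ^ k)\<^sup>2"
proof -
  have S: "S \<subseteq> binary_trees k" using assms(1) by (auto simp: binary_trees_def)
  have gf: "tree_gf f $ i = (if i = k then card S / 4 ^ k else 0)" for i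
  proof -
    have "(\<Sum>t\<in>binary_trees i. f t) = real (card (binary_trees i \<inter> S))"
      by (simp add: f_def finite_binary_trees of_bool_def sum.If_cases)
    moreover have "binary_trees i \<inter> S = (if i = k then S else {})"
      using S assms(1) by (auto simp: binary_trees_def)
    ultimately show ?thesis by (simp add: tree_gf_nth)
  qed
  have square: "(\<lambda>t. f t * (2 * fringe_sum f t - f t)) = f"
    unfolding f_def by (rule ext, rule fringe_sum_same_size_square[OF assms(1,2)])
  have "f Leaf = 0" "f t \<ge> 0" for t
    using assms(1)[of Leaf] assms(2) by (auto simp: f_def)
  then have "expect n (\<lambda>t. (fringe_sum f t)\<^sup>2) - expect n (fringe_sum f)
      \<le> real n * (real n + 1) * (\<Sum>i\<le>n. tree_gf f $ i)\<^sup>2"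
    using expect_fringe_sum_square_le[of f n] unfolding square by (simp add: algebra_simps)
  then have "expect n (\<lambda>t. (fringe_sum f t)\<^sup>2 - fringe_sum f t)
      \<le> real n * (real n + 1) * (\<Sum>i\<le>n. tree_gf f $ i)\<^sup>2"
    by (simp only: expect_diff)
  also have "(\<Sum>i\<le>n. tree_gf f $ i) = (if k \<le> n then card S / 4 ^ k else 0)"
    by (simp add: gf)
  also have "real n * (real n + 1) * (if k \<le> n then card S / 4 ^ k else 0)\<^sup>2 \<le> real n * (real n + 1) * (card S / 4 ^ k)\<^sup>2"
    by simp
  finally show ?thesis .
qed

text \<open>Occurrence counts are real-valued here; this is the integrality needed for N^2 - N \<ge>
  0.\<close>

lemma fringe_sum_of_bool_cases: "fringe_sum (\<lambda>t. of_bool (P t)) t = 0 \<or> fringe_sum (\<lambda>t. of_bool (P t)) t \<ge> 1"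
  by (induction t) (auto simp: add_increasing)

lemma finite_subtrees: "finite (subtrees t)"
  by (induction t) auto

lemma finite_fringe_subtrees: "finite (fringe_subtrees t)"
  by (simp add: fringe_subtrees_def finite_subtrees)

lemma fringe_subtrees_Node: "fringe_subtrees (Node l x r) = insert (Node l x r) (fringe_subtrees l \<union> fringe_subtrees r)"
  by (auto simp: fringe_subtrees_def)

lemma fringe_subtrees_Leaf: "fringe_subtrees Leaf = {}"
  by (simp add: fringe_subtrees_def)

text \<open>\<open>fringe_subtrees\<close> is a set of trees and merges equal ones, while the fringe
  sum counts them with multiplicity.\<close>

lemma card_fringe_subtrees_le:
  "real (card {s \<in> fringe_subtrees t. P s}) \<le> fringe_sum (\<lambda>s. of_bool (P s)) t"
proof (induction t)
  case (Node l x r)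
  have "{s \<in> fringe_subtrees (Node l x r). P s} \<subseteq> (if P (Node l x r) then {Node l x r} else {})
      \<union> ({s \<in> fringe_subtrees l. P s} \<union> {s \<in> fringe_subtrees r. P s})"
    by (auto simp: fringe_subtrees_Node)
  from card_mono[OF _ this] have "card {s \<in> fringe_subtrees (Node l x r). P s} \<le>
     card (if P (Node l x r) then {Node l x r} else {}) +
      (card {s \<in> fringe_subtrees l. P s} + card {s \<in> fringe_subtrees r. P s})"
    by (intro order.trans[OF _ order.trans[OF card_Un_le add_left_mono[OF card_Un_le]]]) (auto simp: finite_fringe_subtrees)
  then show ?case using Node by (auto split: if_splits)
qed (simp add: fringe_subtrees_Leaf)

lemma fringe_sum_eq_0I: "(\<And>s. s \<in> fringe_subtrees t \<Longrightarrow> f s = 0) \<Longrightarrow> fringe_sum f t = 0"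
  by (induction t) (auto simp: fringe_subtrees_Node)

section \<open>Shapes and their multiplicities\<close>

text \<open>The option type gives the empty tree a shape too, so the two subtrees of any node can be
  compared without case distinction; a childless vertex counts as symmetric.\<close>

definition shape :: "'a tree \<Rightarrow> utree option" where
  "shape t = (if t = Leaf then None else Some (unordered t))"

fun asym_count :: "'a tree \<Rightarrow> nat" where
  "asym_count Leaf = 0"
| "asym_count (Node l x r) = (if shape l = shape r then 0 else 1) + asym_count l + asym_count r"

definition shape_class :: "'a tree \<Rightarrow> 'a tree set" where
  "shape_class t = {s. shape s = shape t}"

definition sym_toll :: "'a tree \<Rightarrow> real" where
  "sym_toll t = (case t of Leaf \<Rightarrow> 0 | Node l x r \<Rightarrow> of_bool (shape l = shape r))"

text \<open>Truncation by height keeps the sets finite and makes each one consist of all pairs from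
  the previous one, so truncated sums satisfy an exact recursion. Shape classes are never cut, as
  height depends only on the shape.\<close>

definition trees_of_height :: "nat \<Rightarrow> unit tree set" where
  "trees_of_height h = {t. height t \<le> h}"

text \<open>
  Since a shape $T$ has \<open>2 ^ asym_count t\<close> representatives, $v = 2^{j-1}$ and $x = 4^{-j}$ give
  $\sum_T P(T)^j$, and $v = 1/2$ gives $\sum_T x^{|T|}$, both over the shapes of height at most $h$.
\<close>

definition shape_sum :: "real \<Rightarrow> real \<Rightarrow> nat \<Rightarrow> real" where
  "shape_sum x v h = (\<Sum>t\<in>trees_of_height h. x ^ size t * v ^ asym_count t)"

lemma shape_Leaf [simp]: "shape Leaf = None" and shape_eq_None [simp]: "shape t = None \<longleftrightarrow> t = Leaf"
  and shape_neq_None [simp]: "None = shape t \<longleftrightarrow> t = Leaf"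
  by (auto simp: shape_def)

lemma shape_Node_eq_iff:
  "shape (Node l x r) = shape (Node l' y r') \<longleftrightarrow>
     shape l = shape l' \<and> shape r = shape r' \<or> shape l = shape r' \<and> shape r = shape l'"
  by (auto simp: shape_def add_eq_conv_ex)

lemma fringe_sum_sym_toll: "fringe_sum sym_toll t = real (size t) - real (asym_count t)"
  by (induction t) (auto simp: sym_toll_def)

lemma shape_eqD:
  assumes "shape s = shape t"
  shows "size s = size t" "asym_count s = asym_count t" "height s = height t"
proof -
  have "size s = size t \<and> asym_count s = asym_count t \<and> height s = height t"
    using assms
  proof (induction s arbitrary: t)
    case (Node l x r)
    then obtain l' y r' where t: "t = Node l' y r'" by (cases t) auto
    from Node.prems[unfolded t shape_Node_eq_iff] show ?case
    proof
      assume "shape l = shape l' \<and> shape r = shape r'"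
      then show ?thesis using Node.IH[of l'] Node.IH(2)[of r'] by (simp add: t)
    next
      assume "shape l = shape r' \<and> shape r = shape l'"
      then show ?thesis using Node.IH(1)[of r'] Node.IH(2)[of l'] by (auto simp: t max.commute)
    qed
  qed auto
  then show "size s = size t" "asym_count s = asym_count t" "height s = height t" by auto
qed

text \<open>A representative chooses one representative for each of the two subtree shapes and an
  order. The two orders give disjoint sets if the shapes differ and the same set otherwise.\<close>

lemma card_shape_class:
  fixes t :: "unit tree"
  shows "finite (shape_class t) \<and> card (shape_class t) = 2 ^ asym_count t"
proof (induction t)
  case Leaf
  have "shape_class (Leaf :: unit tree) = {Leaf}" by (auto simp: shape_class_def)
  then show ?case by simp
next
  case (Node l x r)
  let ?N = "\<lambda>(a, b). Node a () b"
  have inj: "inj_on ?N A" for A by (auto simp: inj_on_def)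
  have eq: "shape_class (Node l x r) = ?N ` (shape_class l \<times> shape_class r \<union> shape_class r \<times> shape_class l)"
  proof (intro equalityI subsetI)
    fix s assume s: "s \<in> shape_class (Node l x r)"
    then obtain a y b where "s = Node a y b" by (cases s) (auto simp: shape_class_def)
    with s show "s \<in> ?N ` (shape_class l \<times> shape_class r \<union> shape_class r \<times> shape_class l)"
      by (auto simp: shape_class_def shape_Node_eq_iff intro!: image_eqI[of _ _ "(a, b)"])
  qed (auto simp: shape_class_def shape_Node_eq_iff)
  have fin: "finite (shape_class l \<times> shape_class r \<union> shape_class r \<times> shape_class l)"
    using Node by simp
  have "card (shape_class l \<times> shape_class r \<union> shape_class r \<times> shape_class l) = 2 ^ asym_count (Node l x r)"
  proof (cases "shape l = shape r")
    case True
    then have "shape_class l = shape_class r" by (simp add: shape_class_def)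
    then have "shape_class l \<times> shape_class r \<union> shape_class r \<times> shape_class l = shape_class l \<times> shape_class r" by auto
    then show ?thesis using Node True by (simp add: card_cartesian_product power_add)
  next
    case False
    then have "(shape_class l \<times> shape_class r) \<inter> (shape_class r \<times> shape_class l) = {}"
      by (auto simp: shape_class_def)
    then show ?thesis using Node False
      by (simp add: card_Un_disjoint card_cartesian_product power_add)
  qed
  then show ?case unfolding eq using fin by (simp add: card_image[OF inj])
qed

section \<open>Sums over trees of bounded height\<close>

lemma trees_of_height_0: "trees_of_height 0 = {Leaf}"
  by (auto simp: trees_of_height_def)

lemma trees_of_height_Suc:
  "trees_of_height (Suc h) = insert Leaf ((\<lambda>(l, r). Node l () r) ` (trees_of_height h \<times> trees_of_height h))"
proof (rule set_eqI)
  fix t :: "unit tree"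
  show "t \<in> trees_of_height (Suc h) \<longleftrightarrow> t \<in> insert Leaf ((\<lambda>(l, r). Node l () r) ` (trees_of_height h \<times> trees_of_height h))"
    by (cases t) (auto simp: trees_of_height_def image_iff)
qed

lemma finite_trees_of_height: "finite (trees_of_height h)"
  by (induction h) (auto simp: trees_of_height_0 trees_of_height_Suc)

lemma sum_trees_of_height_Suc:
  fixes g :: "unit tree \<Rightarrow> real"
  shows "(\<Sum>t\<in>trees_of_height (Suc h). g t) =
    g Leaf + (\<Sum>l\<in>trees_of_height h. \<Sum>r\<in>trees_of_height h. g (Node l () r))"
proof -
  have "(\<Sum>t\<in>trees_of_height (Suc h). g t) =
      g Leaf + (\<Sum>t\<in>(\<lambda>(l, r). Node l () r) ` (trees_of_height h \<times> trees_of_height h). g t)"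
    unfolding trees_of_height_Suc by (subst sum.insert) (auto simp: finite_trees_of_height)
  also have "(\<Sum>t\<in>(\<lambda>(l, r). Node l () r) ` (trees_of_height h \<times> trees_of_height h). g t) =
      (\<Sum>(l, r)\<in>trees_of_height h \<times> trees_of_height h. g (Node l () r))"
    by (subst sum.reindex) (auto simp: inj_on_def case_prod_unfold)
  finally show ?thesis by (simp add: sum.cartesian_product)
qed

lemma sum_same_shape:
  assumes "\<And>s t. shape s = shape t \<Longrightarrow> g s = (g t :: real)" "l \<in> trees_of_height h"
  shows "(\<Sum>r\<in>trees_of_height h. of_bool (shape l = shape r) * g r) = 2 ^ asym_count l * g l"
proof -
  have "(\<Sum>r\<in>trees_of_height h. of_bool (shape l = shape r) * g r) = (\<Sum>r\<in>shape_class l. g r)"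
  proof (rule sum.mono_neutral_cong_right[OF finite_trees_of_height])
    show "shape_class l \<subseteq> trees_of_height h"
    proof
      fix r assume "r \<in> shape_class l"
      then have "height r = height l" unfolding shape_class_def by (intro shape_eqD(3)) simp
      then show "r \<in> trees_of_height h" using assms(2) by (simp add: trees_of_height_def)
    qed
    show "\<forall>i\<in>trees_of_height h - shape_class l. of_bool (shape l = shape i) * g i = 0"
    proof
      fix i assume "i \<in> trees_of_height h - shape_class l"
      then have "\<not> shape l = shape i" unfolding shape_class_def by (simp add: eq_commute[of "shape l"])
      then show "of_bool (shape l = shape i) * g i = 0" by simp
    qed
    show "of_bool (shape l = shape i) * g i = g i" if "i \<in> shape_class l" for i
    proof -
      have "shape l = shape i" using that unfolding shape_class_def by simp
      then show ?thesis by simp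
    qed
  qed
  also have "\<dots> = (\<Sum>r\<in>shape_class l. g l)"
    by (intro sum.cong refl assms(1)) (simp add: shape_class_def)
  finally show ?thesis by (simp add: card_shape_class)
qed

lemma shape_sum_0 [simp]: "shape_sum x v 0 = 1"
  by (simp add: shape_sum_def trees_of_height_0)

text \<open>Every pair of subtrees is weighted with v, as if the shapes differed; pairs of equal
  shape then lack 1 - v. On these pairs x and v are squared, and the \<open>2 ^ asym_count l\<close>
  choices of the second subtree turn v^2 into 2 v^2.\<close>

lemma shape_sum_Suc:
  "shape_sum x v (Suc h) = 1 + x * (v * (shape_sum x v h)\<^sup>2 + (1 - v) * shape_sum (x\<^sup>2) (2 * v\<^sup>2) h)"
proof -
  define g where "g t = x ^ size t * v ^ asym_count t" for t :: "unit tree"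
  have gs: "g s = g t" if "shape s = shape t" for s t
    using shape_eqD[OF that] by (simp add: g_def)
  have "g (Node l () r) = x * v * (g l * g r) + x * (1 - v) * (g l * (of_bool (shape l = shape r) * g r))" for l r
    by (simp add: g_def power_add algebra_simps)
  then have "shape_sum x v (Suc h) = 1 + (x * v * (shape_sum x v h * shape_sum x v h)
      + x * (1 - v) * (\<Sum>l\<in>trees_of_height h. g l * (\<Sum>r\<in>trees_of_height h. of_bool (shape l = shape r) * g r)))"
    unfolding shape_sum_def g_def[symmetric] sum_trees_of_height_Suc
    by (simp add: sum.distrib sum_distrib_left[symmetric] sum_product) (simp add: g_def)
  also have "(\<Sum>l\<in>trees_of_height h. g l * (\<Sum>r\<in>trees_of_height h. of_bool (shape l = shape r) * g r))
     = (\<Sum>l\<in>trees_of_height h. g l * (2 ^ asym_count l * g l))"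
    by (intro sum.cong refl arg_cong[of _ _ "(*) _"] sum_same_shape gs)
  also have "\<dots> = shape_sum (x\<^sup>2) (2 * v\<^sup>2) h"
    unfolding shape_sum_def
    by (intro sum.cong refl) (simp add: g_def power_mult_distrib power2_eq_square)
  finally show ?thesis by (simp add: power2_eq_square algebra_simps)
qed

lemma shape_sum_mono:
  assumes "x \<ge> 0" "v \<ge> 0" "h \<le> h'"
  shows "shape_sum x v h \<le> shape_sum x v h'"
  unfolding shape_sum_def
proof (rule sum_mono2[OF finite_trees_of_height])
  show "trees_of_height h \<subseteq> trees_of_height h'"
    using assms by (auto simp: trees_of_height_def)
qed (use assms in auto)

lemma shape_sum_ge_1: "x \<ge> 0 \<Longrightarrow> v \<ge> 0 \<Longrightarrow> shape_sum x v h \<ge> 1"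
  using shape_sum_mono[of x v 0 h] by simp

text \<open>The inner sum over the mirror images of \<open>l\<close> is $P([l])$, so the toll collects $\frac14\sum_T P(T)^2$.\<close>

lemma sum_sym_toll:
  "(\<Sum>t\<in>trees_of_height (Suc h). sym_toll t / 4 ^ size t) = shape_sum (1/16) 2 h / 4"
proof -
  have toll: "sym_toll (Node l () r) / 4 ^ size (Node l () r) =
      1 / 4 * (1/4) ^ size l * (of_bool (shape l = shape r) * (1/4) ^ size r)" for l r :: "unit tree"
    by (simp add: sym_toll_def power_add power_one_over)
  have "(\<Sum>t\<in>trees_of_height (Suc h). sym_toll t / 4 ^ size t) =
     (\<Sum>l\<in>trees_of_height h. 1 / 4 * (1/4) ^ size l * (\<Sum>r\<in>trees_of_height h. of_bool (shape l = shape r) * (1/4) ^ size r))"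
    unfolding sum_trees_of_height_Suc sum_distrib_left toll by (simp add: sym_toll_def)
  also have "\<dots> = (\<Sum>l\<in>trees_of_height h. 1 / 4 * (1/4) ^ size l * (2 ^ asym_count l * (1/4) ^ size l))"
    by (intro sum.cong refl arg_cong[of _ _ "(*) _"] sum_same_shape) (metis shape_eqD(1))
  also have "\<dots> = shape_sum (1/16) 2 h / 4"
    unfolding shape_sum_def sum_divide_distrib
  proof (intro sum.cong refl)
    fix l :: "unit tree"
    have "(1/4::real) ^ size l * (1/4) ^ size l = (1/16) ^ size l"
      by (simp flip: power_mult_distrib)
    then show "1 / 4 * (1/4::real) ^ size l * (2 ^ asym_count l * (1/4) ^ size l) = (1/16) ^ size l * 2 ^ asym_count l / 4"
      by (simp add: field_simps)
  qed
  finally show ?thesis .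
qed

text \<open>A class has \<open>2 ^ asym_count t\<close> members of weight
  \<open>(1/2) ^ asym_count t\<close> each, hence total weight 1.\<close>

lemma sum_over_shapes:
  assumes "finite A" "\<And>s t. t \<in> A \<Longrightarrow> shape s = shape t \<Longrightarrow> s \<in> A"
  shows "(\<Sum>t\<in>A. (1/2) ^ asym_count t) = real (card (shape ` (A :: unit tree set)))"
proof -
  have "(\<Sum>t\<in>A. (1/2::real) ^ asym_count t) = (\<Sum>c\<in>shape ` A. \<Sum>t\<in>{t \<in> A. shape t = c}. (1/2) ^ asym_count t)"
    by (rule sum.image_gen[OF assms(1)])
  also have "\<dots> = (\<Sum>c\<in>shape ` A. 1)"
  proof (rule sum.cong[OF refl])
    fix c assume "c \<in> shape ` A"
    then obtain t where t: "t \<in> A" "c = shape t" by blast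
    then have "{s \<in> A. shape s = c} = shape_class t" using assms(2) by (auto simp: shape_class_def)
    moreover have "(\<Sum>s\<in>shape_class t. (1/2::real) ^ asym_count s) = (\<Sum>s\<in>shape_class t. (1/2) ^ asym_count t)"
    proof (rule sum.cong[OF refl])
      fix s assume "s \<in> shape_class t"
      then have "asym_count s = asym_count t" unfolding shape_class_def by (intro shape_eqD(2)) simp
      then show "(1/2::real) ^ asym_count s = (1/2) ^ asym_count t" by simp
    qed
    ultimately show "(\<Sum>t\<in>{t \<in> A. shape t = c}. (1/2::real) ^ asym_count t) = 1"
      by (simp add: card_shape_class power_divide)
  qed
  finally show ?thesis by simp
qed

text \<open>Rankin's trick: for x \<le> 1 each shape of size at most m contributes at least x^m to
  the generating function of shapes.\<close>

lemma card_shapes_le: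
  assumes "0 < x" "x \<le> 1" "\<And>h. shape_sum x (1/2) h \<le> B"
  shows "real (card (shape ` {t :: unit tree. size t \<le> m})) \<le> B * (1 / x) ^ m"
proof -
  let ?A = "{t :: unit tree. size t \<le> m}"
  have sub: "?A \<subseteq> trees_of_height m"
    using height_le_size_tree order_trans by (auto simp: trees_of_height_def)
  have fin: "finite ?A" by (rule finite_subset[OF sub finite_trees_of_height])
  have "real (card (shape ` ?A)) * x ^ m = (\<Sum>t\<in>?A. x ^ m * (1/2) ^ asym_count t)"
  proof -
    have "(\<Sum>t\<in>?A. (1/2) ^ asym_count t) = real (card (shape ` ?A))"
      by (rule sum_over_shapes[OF fin]) (metis mem_Collect_eq shape_eqD(1))
    then show ?thesis by (simp add: sum_distrib_left[symmetric] mult.commute)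
  qed
  also have "\<dots> \<le> (\<Sum>t\<in>?A. x ^ size t * (1/2) ^ asym_count t)"
    using assms by (intro sum_mono mult_right_mono power_decreasing) auto
  also have "\<dots> \<le> shape_sum x (1/2) m"
    unfolding shape_sum_def using assms by (intro sum_mono2 sub finite_trees_of_height) auto
  also have "\<dots> \<le> B" by (rule assms)
  finally show ?thesis using assms by (simp add: field_simps power_divide)
qed

section \<open>Numerical bounds for the constants\<close>

lemma arctan_bounds_sum:
  assumes "0 < x" "x \<le> (1::real)"
  shows "(\<Sum>k<2*n. (-1)^k * (1 / real (k*2+1) * x^(k*2+1))) \<le> arctan x"
    and "arctan x \<le> (\<Sum>k<2*n+1. (-1)^k * (1 / real (k*2+1) * x^(k*2+1)))"
proof -
  have x: "\<bar>x\<bar> \<le> 1" using assms by simp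
  note L = summable_Leibniz[OF zeroseq_arctan_series[OF x] monoseq_arctan_series[OF x]]
  have "\<forall>n. arctan x \<in> {\<Sum>i<2*n. (-1)^i * (1 / real (i*2+1) * x^(i*2+1))..\<Sum>i<2*n+1. (-1)^i * (1 / real (i*2+1) * x^(i*2+1))}"
    using L(2) assms unfolding arctan_series[OF x] by simp
  then show "(\<Sum>k<2*n. (-1)^k * (1 / real (k*2+1) * x^(k*2+1))) \<le> arctan x"
    and "arctan x \<le> (\<Sum>k<2*n+1. (-1)^k * (1 / real (k*2+1) * x^(k*2+1)))"
    by auto
qed

text \<open>Machin's formula with alternating partial sums of the arctangent series. The prescribed
  decimals of the two constants leave very little room, hence the many digits.\<close>

lemma pi_bounds: "3.1415926535897 \<le> pi" "pi \<le> 3.1415926535899"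
proof -
  note [simp] = eval_nat_numeral
  have a: "arctan (1/5) \<ge> 0.19739555984988" "arctan (1/5) \<le> 0.197395559849885"
    using arctan_bounds_sum(1)[of "1/5" 5] arctan_bounds_sum(2)[of "1/5" 5] by simp_all
  have b: "arctan (1/239) \<ge> 0.00418407600207" "arctan (1/239) \<le> 0.00418407600208"
    using arctan_bounds_sum(1)[of "1/239" 2] arctan_bounds_sum(2)[of "1/239" 1] by simp_all
  show "3.1415926535897 \<le> pi" "pi \<le> 3.1415926535899"
    using a b machin by simp_all
qed

lemma ln_2_lower: "0.6931471805599 \<le> ln (2::real)"
  using ln_approx_bounds[of 2 13] by (simp add: eval_nat_numeral)

lemma ln_2_upper: "ln (2::real) \<le> 0.69314718056"
  using ln_approx_bounds[of 2 13] by (simp add: eval_nat_numeral)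

text \<open>The fraction lies just above \<beta> = 2.4832535..., the growth rate of the
  Wedderburn-Etherington numbers. Splitting off ln 2 brings the argument nearer to 1, where few
  terms suffice.\<close>

lemma ln_beta_upper: "ln (227692 / 91691 :: real) \<le> 0.90956961019"
proof -
  have "ln (227692 / 91691 :: real) = ln 2 + ln (113846 / 91691)"
    by (subst ln_mult_pos[symmetric]) auto
  also have "ln (113846 / 91691 :: real) \<le> 0.21642242963"
    using ln_approx_bounds[of "113846 / 91691" 6] by (simp add: eval_nat_numeral)
  finally show ?thesis using ln_2_upper by simp
qed

section \<open>An upper bound for the growth rate of the number of shapes\<close>

lemma shape_sum_half_Suc:
  "shape_sum x (1/2) (Suc h) = 1 + x / 2 * ((shape_sum x (1/2) h)\<^sup>2 + shape_sum (x\<^sup>2) (1/2) h)"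
  by (simp add: shape_sum_Suc power2_eq_square algebra_simps)

lemma shape_sum_nonneg: "x \<ge> 0 \<Longrightarrow> v \<ge> 0 \<Longrightarrow> shape_sum x v h \<ge> 0"
  using shape_sum_ge_1[of x v h] by simp

text \<open>For v = 1/2 the parameter 2 v^2 is again 1/2, so only x is squared along the recursion.
  The chain of powers is stopped by bounding the sum at x^2 by the one at x.\<close>

lemma shape_sum_half_crude:
  assumes "0 \<le> x" "x \<le> 1" "1 + x / 2 * (B\<^sup>2 + B) \<le> B" "1 \<le> B"
  shows "shape_sum x (1/2) h \<le> B"
proof (induction h)
  case (Suc h)
  have "shape_sum (x\<^sup>2) (1/2) h \<le> shape_sum x (1/2) h"
    unfolding shape_sum_def using assms
    by (intro sum_mono mult_right_mono power_mono) (auto simp: power2_eq_square mult_left_le)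
  then have "(shape_sum x (1/2) h)\<^sup>2 + shape_sum (x\<^sup>2) (1/2) h \<le> B\<^sup>2 + B"
    using Suc assms shape_sum_nonneg[of x "1/2" h] by (intro add_mono power_mono) auto
  then have "shape_sum x (1/2) (Suc h) \<le> 1 + x / 2 * (B\<^sup>2 + B)"
    unfolding shape_sum_half_Suc using assms by (intro add_left_mono mult_left_mono) auto
  then show ?case using assms by linarith
qed (use assms in simp)

text \<open>The third assumption says that the recursion, with C in place of the sum at x^2, does
  not lead out of the range below B.\<close>

lemma shape_sum_half_le:
  assumes "0 \<le> x" "\<And>h. shape_sum (x\<^sup>2) (1/2) h \<le> C" "1 + x / 2 * (B\<^sup>2 + C) \<le> B" "1 \<le> B"
  shows "shape_sum x (1/2) h \<le> B"
proof (induction h)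
  case (Suc h)
  have "(shape_sum x (1/2) h)\<^sup>2 + shape_sum (x\<^sup>2) (1/2) h \<le> B\<^sup>2 + C"
    using Suc assms shape_sum_nonneg[of x "1/2" h] by (intro add_mono power_mono) auto
  then have "shape_sum x (1/2) (Suc h) \<le> 1 + x / 2 * (B\<^sup>2 + C)"
    unfolding shape_sum_half_Suc using assms by (intro add_left_mono mult_left_mono) auto
  then show ?case using assms by linarith
qed (use assms in simp)

text \<open>
  For the limit $V(x)$ of \<open>shape_sum x (1/2)\<close>, the quadratic equation for $V(x)$ has the double root
  $1/x$ at the radius of convergence, where $1/x = 1 + \sqrt{1 + V(x^2)}$; the $x$ below lies just inside.
\<close>

lemma shape_sum_half_bounded: "shape_sum (91691 / 227692) (1/2) h \<le> 227692 / 91691"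
proof -
  define x :: real where "x = 91691 / 227692"
  \<comment> \<open>x^16 is below 5 / 10^7, small enough for the crude bound; the next bounds are
    the smaller roots of the respective quadratics, rounded up.\<close>
  have "shape_sum (x ^ 16) (1/2) h \<le> 1.000001" for h
    by (rule shape_sum_half_crude) (simp_all add: x_def power_divide eval_nat_numeral)
  then have "shape_sum ((x ^ 8)\<^sup>2) (1/2) h \<le> 1.000001" for h by simp
  then have "shape_sum (x ^ 8) (1/2) h \<le> 5003460209/5000000000" for h
    by (rule shape_sum_half_le[rotated]) (simp_all add: x_def power_divide eval_nat_numeral)
  then have "shape_sum ((x ^ 4)\<^sup>2) (1/2) h \<le> 5003460209/5000000000" for h by simp
  then have "shape_sum (x ^ 4) (1/2) h \<le> 1027027027393/1000000000000" for h
    by (rule shape_sum_half_le[rotated]) (simp_all add: x_def power_divide eval_nat_numeral)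
  then have "shape_sum ((x ^ 2)\<^sup>2) (1/2) h \<le> 1027027027393/1000000000000" for h by simp
  then have "shape_sum (x ^ 2) (1/2) h \<le> 12000410525361/10000000000000" for h
    by (rule shape_sum_half_le[rotated]) (simp_all add: x_def power_divide eval_nat_numeral)
  then have "shape_sum x (1/2) h \<le> 227692 / 91691"
    by (rule shape_sum_half_le[rotated]) (simp_all add: x_def power_divide eval_nat_numeral)
  then show ?thesis by (simp add: x_def)
qed

section \<open>Lower bound for \<mu>\<close>

lemma shape_sum_le_2:
  assumes "0 \<le> x" "1 \<le> v" "x * v \<le> 1/4"
  shows "shape_sum x v h \<le> 2"
proof (induction h)
  case (Suc h)
  have "v * (shape_sum x v h)\<^sup>2 + (1 - v) * shape_sum (x\<^sup>2) (2 * v\<^sup>2) h \<le> v * 2\<^sup>2 + 0"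
    using Suc assms shape_sum_nonneg[of x v h] shape_sum_nonneg[of "x\<^sup>2" "2 * v\<^sup>2" h]
    by (intro add_mono mult_left_mono power_mono mult_nonpos_nonneg) auto
  then have "shape_sum x v (Suc h) \<le> 1 + x * (v * 2\<^sup>2 + 0)"
    unfolding shape_sum_Suc using assms by (intro add_left_mono mult_left_mono) auto
  then show ?case using assms(3) by simp
qed simp

text \<open>For v \<ge> 1 the factor 1 - v is not positive, so an upper bound needs a lower bound at
  the next pair of parameters and vice versa. The pairs are (4^(-j), 2^(j-1)) for j = 2, 4, 8, 16,
  bounded from below, above, below and above.\<close>

lemma shape_sum_Suc_le:
  assumes "0 \<le> x" "1 \<le> v" "shape_sum x v h \<le> A" "C \<le> shape_sum (x\<^sup>2) (2 * v\<^sup>2) h"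
  shows "shape_sum x v (Suc h) \<le> 1 + x * (v * A\<^sup>2 + (1 - v) * C)"
  unfolding shape_sum_Suc using assms shape_sum_nonneg[of x v h]
  by (intro add_left_mono mult_left_mono add_mono mult_left_mono_neg power_mono) auto

lemma shape_sum_Suc_ge:
  assumes "0 \<le> x" "1 \<le> v" "A \<le> shape_sum x v h" "0 \<le> A" "shape_sum (x\<^sup>2) (2 * v\<^sup>2) h \<le> C"
  shows "1 + x * (v * A\<^sup>2 + (1 - v) * C) \<le> shape_sum x v (Suc h)"
  unfolding shape_sum_Suc using assms
  by (intro add_left_mono mult_left_mono add_mono mult_left_mono_neg power_mono) auto

lemma shape_sum_limit:
  assumes "0 \<le> x" "1 \<le> v" "x * v \<le> 1/4"
  obtains L where "shape_sum x v \<longlonglongrightarrow> L" "\<And>h. shape_sum x v h \<le> L" "L \<le> 2"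
proof -
  have inc: "incseq (shape_sum x v)" using assms by (auto simp: incseq_def intro!: shape_sum_mono)
  obtain L where L: "shape_sum x v \<longlonglongrightarrow> L" "\<forall>h. shape_sum x v h \<le> L"
    using incseq_convergent[OF inc] shape_sum_le_2[OF assms] by metis
  moreover have "L \<le> 2" using LIMSEQ_le_const2[OF L(1)] shape_sum_le_2[OF assms] by blast
  ultimately show ?thesis using that by blast
qed

lemma shape_sum_16_le: "shape_sum (1 / 2 ^ 32) 32768 h \<le> 1 + 1 / 2 ^ 30"
proof -
  \<comment> \<open>Discarding the negative term gives this bound; a second round with the trivial
    lower bound 1 for that term cancels all but about 2 / 2^32.\<close>
  have crude: "shape_sum (1 / 2 ^ 32) 32768 h \<le> 1 + 1 / 2 ^ 16" for h
  proof (induction h)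
    case (Suc h)
    have "shape_sum (1 / 2 ^ 32) 32768 (Suc h) \<le> 1 + (1 / 2 ^ 32) * (32768 * (1 + 1 / 2 ^ 16)\<^sup>2 + (1 - 32768) * 0)"
      by (rule shape_sum_Suc_le) (use Suc shape_sum_nonneg in auto)
    then show ?case by (simp add: power2_eq_square)
  qed simp
  show ?thesis
  proof (cases h)
    case (Suc k)
    have "shape_sum (1 / 2 ^ 32) 32768 (Suc k) \<le> 1 + (1 / 2 ^ 32) * (32768 * (1 + 1 / 2 ^ 16)\<^sup>2 + (1 - 32768) * 1)"
      by (rule shape_sum_Suc_le) (use crude[of k] shape_sum_ge_1 in auto)
    then show ?thesis by (simp add: power2_eq_square Suc)
  qed simp
qed

text \<open>Two rounds of the recursion from the trivial bound 1, hence heights of at least 2. The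
  intermediate value is 1 + 2^(-16), rounded down.\<close>

lemma shape_sum_8_ge: "1.00001531839 \<le> shape_sum (1 / 65536) 128 (Suc (Suc h))"
proof -
  have le: "shape_sum ((1 / 65536)\<^sup>2) (2 * 128\<^sup>2) h \<le> 1 + 1 / 2 ^ 30" for h
    using shape_sum_16_le[of h] by (simp add: power2_eq_square)
  have 1: "1 + 1 / 65536 * (128 * 1\<^sup>2 + (1 - 128) * (1 + 1 / 2 ^ 30)) \<le> shape_sum (1 / 65536) 128 (Suc h)"
    by (rule shape_sum_Suc_ge) (use le shape_sum_ge_1 in auto)
  have "1 + 1 / 65536 * (128 * (1.0000152587)\<^sup>2 + (1 - 128) * (1 + 1 / 2 ^ 30)) \<le> shape_sum (1 / 65536) 128 (Suc (Suc h))"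
    by (rule shape_sum_Suc_ge) (use le 1 in auto)
  then show ?thesis by (simp add: power2_eq_square)
qed

text \<open>The limit L satisfies a quadratic inequality, so it lies below the smaller root or above
  the larger one, and L \<le> 2 excludes the latter. The fraction is the smaller root, rounded
  up.\<close>

lemma shape_sum_4_le: "shape_sum (1 / 256) 8 h \<le> 502083399311/500000000000"
proof -
  obtain L where L: "shape_sum (1/256) 8 \<longlonglongrightarrow> L" "\<And>h. shape_sum (1/256) 8 h \<le> L" "L \<le> 2"
    by (rule shape_sum_limit[of "1/256" 8]) auto
  have L1: "L \<ge> 1" using L(2)[of 0] by simp
  \<comment> \<open>Two levels for the lower bound at the next parameters, one for the recursion;
    the resulting restriction to h \<ge> 3 does not affect the limit.\<close>
  have "shape_sum (1/256) 8 (Suc (Suc (Suc h))) \<le> 1 + 1/256 * (8 * L\<^sup>2 + (1 - 8) * 1.00001531839)" for h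
    by (rule shape_sum_Suc_le) (use L(2) shape_sum_8_ge[of h] in \<open>auto simp: power2_eq_square\<close>)
  then have "L \<le> 1 + 1/256 * (8 * L\<^sup>2 + (1 - 8) * 1.00001531839)"
    by (intro LIMSEQ_le_const2[OF L(1)] exI[of _ 3]) (metis Suc_le_D add_Suc numeral_3_eq_3 Suc_le_mono)
  moreover define q :: real where "q = 502083399311/500000000000"
  ultimately have "(L - q) * (1 - (L + q) / 32) \<le> 1 + 1/32 * q\<^sup>2 - 7/256 * 1.00001531839 - q"
    by (simp add: field_simps power2_eq_square)
  also have "\<dots> \<le> 0" by (simp add: q_def power2_eq_square)
  finally have "L \<le> q"
    using L(3) L1 by (auto simp: mult_le_0_iff q_def)
  then show ?thesis using L(2)[of h] by (simp add: q_def)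
qed

text \<open>The same argument with a quadratic reversed by the sign of 1 - v. The root is rounded
  down to p, and the stated number lies strictly below p, so that some finite height already exceeds
  it.\<close>

lemma shape_sum_2_ge: "\<exists>h. shape_sum (1 / 16) 2 h \<ge> 1.08416677443"
proof -
  obtain L where L: "shape_sum (1/16) 2 \<longlonglongrightarrow> L" "\<And>h. shape_sum (1/16) 2 h \<le> L" "L \<le> 2"
    by (rule shape_sum_limit[of "1/16" 2]) auto
  have L1: "L \<ge> 1" using L(2)[of 0] by simp
  define q :: real where "q = 502083399311/500000000000"
  define p :: real where "p = 1084166774433/1000000000000"
  have "(\<lambda>h. 1 + 1/16 * (2 * (shape_sum (1/16) 2 h)\<^sup>2 + (1 - 2) * q)) \<longlonglongrightarrow> 1 + 1/16 * (2 * L\<^sup>2 + (1 - 2) * q)"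
    by (intro tendsto_intros L)
  moreover have "1 + 1/16 * (2 * (shape_sum (1/16) 2 h)\<^sup>2 + (1 - 2) * q) \<le> L" for h
  proof -
    have "1 + 1/16 * (2 * (shape_sum (1/16) 2 h)\<^sup>2 + (1 - 2) * q) \<le> shape_sum (1/16) 2 (Suc h)"
      by (rule shape_sum_Suc_ge) (use shape_sum_4_le[of h] shape_sum_nonneg[of "1/16" 2 h] in \<open>auto simp: q_def power2_eq_square\<close>)
    then show ?thesis using L(2)[of "Suc h"] by linarith
  qed
  ultimately have "1 + 1/16 * (2 * L\<^sup>2 + (1 - 2) * q) \<le> L"
    by (intro LIMSEQ_le_const2) auto
  then have "(p - L) * (1 - (p + L) / 8) \<le> p - (1 + 1/8 * p\<^sup>2 - q / 16)"
    by (simp add: field_simps power2_eq_square)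
  also have "\<dots> \<le> 0" by (simp add: p_def q_def power2_eq_square)
  finally have "p \<le> L"
    using L(3) L1 by (auto simp: mult_le_0_iff p_def)
  then have "1.08416677443 < L" by (simp add: p_def)
  then have "\<forall>\<^sub>F h in sequentially. 1.08416677443 < shape_sum (1/16) 2 h"
    by (rule order_tendstoD(1)[OF L(1)])
  then show ?thesis by (auto simp: eventually_sequentially intro: less_imp_le)
qed

text \<open>The threshold log n / \<kappa> yields the constant c = 2 sqrt(\<kappa> / pi), that is
  \<kappa> = c^2 pi / 4. The number in the middle is the \<kappa> used later; it needs room on both
  sides.\<close>

lemma lower_constant:
  "\<exists>h. (1.05912614335)\<^sup>2 * pi / 4 < 0.88101896629 \<and> 0.88101896629 < ln 2 * (1 + shape_sum (1 / 16) 2 h / 4)"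
proof -
  obtain h where h: "shape_sum (1 / 16) 2 h \<ge> 1.08416677443" using shape_sum_2_ge by blast
  have "0.88101896629 < 0.6931471805599 * (1 + 1.08416677443 / 4 :: real)" by simp
  also have "\<dots> \<le> ln 2 * (1 + shape_sum (1 / 16) 2 h / 4)"
    using h ln_2_lower by (intro mult_mono) auto
  finally show ?thesis using pi_bounds by (auto simp: power2_eq_square)
qed

lemma upper_constant: "0.90956961022 < (1.07615054545)\<^sup>2 * pi / 4"
  using pi_bounds by (simp add: power2_eq_square)

section \<open>Counting shapes of fringe subtrees\<close>

lemma num_unordered_eq: "num_unordered t = card (shape ` fringe_subtrees t)"
proof -
  have "shape ` fringe_subtrees t = Some ` unordered ` fringe_subtrees t"
    unfolding image_image by (rule image_cong) (auto simp: shape_def fringe_subtrees_def)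
  then show ?thesis by (simp add: num_unordered_def card_image)
qed

lemma finite_size_le: "finite {t :: unit tree. size t \<le> m}"
proof -
  have "{t :: unit tree. size t \<le> m} = (\<Union>k\<le>m. binary_trees k)" by (auto simp: binary_trees_def)
  then show ?thesis by (simp add: finite_binary_trees)
qed

lemma tree_gf_size: "tree_gf (\<lambda>t. of_bool (P (size t) \<and> Q t)) $ i = (if P i then tree_gf (\<lambda>t. of_bool (Q t)) $ i else 0)"
  by (auto simp: tree_gf_nth binary_trees_def intro!: sum.cong)

lemma tree_gf_size': "tree_gf (\<lambda>t. of_bool (P (size t))) $ i = (if P i then catalan_gf $ i else 0)"
  by (auto simp: tree_gf_nth binary_trees_def catalan_gf_def intro!: sum.cong)

lemma sum_tree_gf_window:
  assumes "m \<le> M" "M \<le> n"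
  shows "(\<Sum>i\<le>n. tree_gf (\<lambda>t. of_bool (m < size t \<and> size t \<le> M)) $ i) = 2 * (central (Suc m) - central (Suc M))"
proof -
  have "(\<Sum>i\<le>n. tree_gf (\<lambda>t. of_bool (m < size t \<and> size t \<le> M)) $ i) = (\<Sum>i\<in>{m<..M}. catalan_gf $ i)"
    unfolding tree_gf_size'[of "\<lambda>s. m < s \<and> s \<le> M"]
    by (rule sum.mono_neutral_cong_right) (use assms in auto)
  then show ?thesis using sum_catalan_gf[OF assms(1)] by simp
qed

text \<open>The large fringe subtrees are counted as all vertices minus the small ones, so that the
  toll to be controlled vanishes above size m.\<close>

lemma num_unordered_le:
  assumes "\<And>h. shape_sum x (1/2) h \<le> B" "0 < x" "x \<le> 1"
  shows "real (num_unordered t) \<le> B * (1 / x) ^ m + real (size t) - fringe_sum (\<lambda>s. of_bool (0 < size s \<and> size s \<le> m)) (t :: unit tree)"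
proof -
  let ?F = "fringe_subtrees t"
  have "?F \<subseteq> {t. size t \<le> m} \<union> {s \<in> ?F. m < size s}" by auto
  then have "shape ` ?F \<subseteq> shape ` {t :: unit tree. size t \<le> m} \<union> shape ` {s \<in> ?F. m < size s}"
    unfolding image_Un[symmetric] by (rule image_mono)
  then have "card (shape ` ?F) \<le> card (shape ` {t::unit tree. size t \<le> m}) + card (shape ` {s \<in> ?F. m < size s})"
    by (rule order.trans[OF card_mono card_Un_le, rotated]) (auto simp: finite_size_le finite_fringe_subtrees)
  also have "card (shape ` {s \<in> ?F. m < size s}) \<le> card {s \<in> ?F. m < size s}"
    by (rule card_image_le) (simp add: finite_fringe_subtrees)
  finally have "real (num_unordered t) \<le> real (card (shape ` {t::unit tree. size t \<le> m})) + real (card {s \<in> ?F. m < size s})"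
    unfolding num_unordered_eq by linarith
  also have "real (card {s \<in> ?F. m < size s}) \<le> fringe_sum (\<lambda>s. of_bool (m < size s)) t"
    by (rule card_fringe_subtrees_le)
  also have "\<dots> = real (size t) - fringe_sum (\<lambda>s. of_bool (0 < size s \<and> size s \<le> m)) t"
    by (induction t) (auto simp: not_less of_bool_def)
  also have "real (card (shape ` {t::unit tree. size t \<le> m})) \<le> B * (1 / x) ^ m"
    by (rule card_shapes_le) (use assms in auto)
  finally show ?thesis by simp
qed

text \<open>
  $2N - N^2 \le 1$ bounds the indicator of \<open>N \<ge> 1\<close> from below, so repeated shapes cost at most
  the number of ordered pairs of equal ones.
\<close>

lemma num_unordered_ge:
  assumes "finite U"
  defines "N \<equiv> (\<lambda>u. fringe_sum (\<lambda>s. of_bool (s \<noteq> Leaf \<and> shape s = u)))"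
  shows "(\<Sum>u\<in>U. N u t) - (\<Sum>u\<in>U. (N u t)\<^sup>2 - N u t) \<le> real (num_unordered t)"
proof -
  have "N u t - ((N u t)\<^sup>2 - N u t) \<le> of_bool (u \<in> shape ` fringe_subtrees t)" for u
  proof (cases "u \<in> shape ` fringe_subtrees t")
    case True
    have "0 \<le> (N u t - 1)\<^sup>2" by simp
    then show ?thesis using True by (simp add: power2_eq_square algebra_simps)
  next
    case False
    then have "N u t = 0" unfolding N_def by (intro fringe_sum_eq_0I) auto
    then show ?thesis by simp
  qed
  then have "(\<Sum>u\<in>U. N u t - ((N u t)\<^sup>2 - N u t)) \<le> (\<Sum>u\<in>U. of_bool (u \<in> shape ` fringe_subtrees t))"
    by (rule sum_mono)
  also have "\<dots> = real (card (U \<inter> shape ` fringe_subtrees t))"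
    using assms(1) by (simp add: of_bool_def sum.If_cases)
  also have "\<dots> \<le> real (num_unordered t)"
    unfolding num_unordered_eq by (intro of_nat_mono card_mono) (auto simp: finite_fringe_subtrees)
  finally show ?thesis by (simp only: sum_subtractf)
qed

text \<open>Chebyshev's inequality for a truncated toll: counting symmetric nodes only at fringe
  subtrees of height at most h + 1 can only lower the sum, and the truncated toll still has total
  weight above d.\<close>

lemma expect_few_symmetric:
  assumes "d < shape_sum (1/16) 2 h / 4"
  obtains C where "\<And>n. expect n (\<lambda>t. of_bool (fringe_sum sym_toll t < d * real (size t))) \<le> C / real n" "C \<ge> 0"
proof -
  define \<mu> where "\<mu> = shape_sum (1/16) 2 h / 4"
  define f where "f t = (if height t \<le> Suc h then sym_toll t else 0)" for t :: "unit tree"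
  define m where "m = (2::nat) ^ Suc h"
  define e where "e = \<mu> - d"
  \<comment> \<open>The first entry makes the bound trivial for n < m, the second is the Chebyshev
    bound for n \<ge> m.\<close>
  define C where "C = max (real m) (2 * real m / e\<^sup>2)"
  have e: "e > 0" using assms by (simp add: e_def \<mu>_def)
  have f: "f Leaf = 0" "f t \<ge> 0" "f t \<le> 1" "f t \<le> sym_toll t" for t
    by (auto simp: f_def sym_toll_def split: tree.split)
  have small: "size t \<le> m" if "height t \<le> Suc h" for t :: "unit tree"
    using size1_height[of t] power_increasing[OF that, of "2::nat"] by (simp add: m_def size1_size)
  then have f0: "f t = 0" if "size t > m" for t
    using that by (force simp: f_def)
  have sum_f: "(\<Sum>i\<le>n. tree_gf f $ i) = \<mu>" if "m \<le> n" for n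
  proof -
    have "(\<Sum>i\<le>n. tree_gf f $ i) = (\<Sum>i\<le>n. \<Sum>t\<in>binary_trees i. f t / 4 ^ size t)"
      by (auto simp: tree_gf_nth sum_divide_distrib binary_trees_def intro!: sum.cong)
    also have "\<dots> = (\<Sum>t\<in>(\<Union>i\<le>n. binary_trees i). f t / 4 ^ size t)"
      by (rule sum.UNION_disjoint[symmetric]) (simp_all add: finite_binary_trees, auto simp: binary_trees_def)
    also have "\<dots> = (\<Sum>t\<in>trees_of_height (Suc h). sym_toll t / 4 ^ size t)"
    proof (rule sum.mono_neutral_cong_right)
      show "finite (\<Union>i\<le>n. binary_trees i)" by (simp add: finite_binary_trees)
      show "trees_of_height (Suc h) \<subseteq> (\<Union>i\<le>n. binary_trees i)"
        using small that by (force simp: trees_of_height_def binary_trees_def)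
    qed (auto simp: f_def trees_of_height_def)
    finally show ?thesis by (simp add: sum_sym_toll \<mu>_def)
  qed
  have "expect n (\<lambda>t. of_bool (fringe_sum sym_toll t < d * real (size t))) \<le> C / real n" for n
  proof (cases "n \<ge> m")
    case True
    then have n: "n > 0" by (auto simp: m_def intro: Suc_le_lessD[OF order.trans[rotated]])
    let ?c = "(real n + 1) * (\<Sum>i\<le>n. tree_gf f $ i)"
    have "of_bool (fringe_sum sym_toll t < d * real (size t)) \<le> inverse (e * real n)^2 * (fringe_sum f t - ?c)\<^sup>2"
      if "size t = n" for t
    proof (cases "fringe_sum sym_toll t < d * real (size t)")
      case lt: True
      have "\<mu> \<ge> 0" using shape_sum_nonneg[of "1/16" 2 h] by (simp add: \<mu>_def)
      have "fringe_sum f t \<le> fringe_sum sym_toll t" by (rule fringe_sum_mono) (rule f)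
      also have "\<dots> < d * real n" using lt that by simp
      finally have "e * real n \<le> ?c - fringe_sum f t"
        using \<open>\<mu> \<ge> 0\<close> unfolding sum_f[OF True] by (simp add: e_def algebra_simps)
      then have "(e * real n)\<^sup>2 \<le> (?c - fringe_sum f t)\<^sup>2" using e by (intro power_mono) auto
      then show ?thesis using lt e n by (simp add: power2_commute field_simps)
    qed simp
    then have "expect n (\<lambda>t. of_bool (fringe_sum sym_toll t < d * real (size t)))
      \<le> inverse (e * real n)^2 * expect n (\<lambda>t. (fringe_sum f t - ?c)\<^sup>2)"
      unfolding expect_cmult[symmetric] by (rule expect_mono)
    also have "\<dots> \<le> inverse (e * real n)^2 * (2 * real m * real n)"
      by (intro mult_left_mono expect_fringe_sum_deviation f f0) auto
    also have "\<dots> = (2 * real m / e\<^sup>2) / real n"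
      using e n by (simp add: field_simps power2_eq_square)
    also have "\<dots> \<le> C / real n" by (intro divide_right_mono) (auto simp: C_def)
    finally show ?thesis .
  next
    case False
    show ?thesis
    proof (cases "n = 0")
      case True
      have "of_bool (fringe_sum sym_toll t < d * real (size t)) \<le> (0::real)" if "size t = n" for t :: "unit tree"
        using that True by simp
      then show ?thesis using expect_mono[of n _ "\<lambda>_. 0"] True by simp
    next
      case n: False
      have "expect n (\<lambda>t. of_bool (fringe_sum sym_toll t < d * real (size t))) \<le> expect n (\<lambda>_. 1)"
        by (rule expect_mono) simp
      also have "\<dots> \<le> C / real n" using n False by (simp add: C_def field_simps)
      finally show ?thesis .
    qed
  qed
  moreover have "C \<ge> 0" by (simp add: C_def max.coboundedI1)
  ultimately show ?thesis using that by blast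
qed

text \<open>With s symmetric nodes, \<open>asym_count t - 2 * size t\<close> equals -(size + s), and
  s is at least d times the size.\<close>

lemma shape_probability_le:
  assumes "d * real (size t) \<le> fringe_sum sym_toll t" "m \<le> size t" "0 \<le> d"
  shows "2 ^ asym_count t / 4 ^ size t \<le> 2 powr (- (1 + d) * real m)"
proof -
  have "(2::real) ^ asym_count t / 4 ^ size t = 2 powr (real (asym_count t) - 2 * real (size t))"
    by (simp add: powr_diff powr_realpow flip: powr_powr)
  also have "\<dots> \<le> 2 powr (- (1 + d) * real (size t))"
    using assms(1) by (intro powr_mono) (auto simp: fringe_sum_sym_toll algebra_simps)
  also have "\<dots> \<le> 2 powr (- (1 + d) * real m)"
    using assms(2,3) by (intro powr_mono mult_left_mono_neg) auto
  finally show ?thesis .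
qed

text \<open>The loss has two parts: occurrences with too few symmetric nodes, and ordered pairs of
  equal shapes among the others. The second costs n(n + 1) times the sum of P(T)^2, which is at most
  max P(T) times the sum of P(T), and that sum is at most 2.\<close>

lemma num_unordered_window:
  fixes m M n :: nat and C d :: real
  assumes d: "0 \<le> d" and C: "\<And>n. expect n (\<lambda>t. of_bool (fringe_sum sym_toll t < d * real (size t))) \<le> C / real n" "C \<ge> 0"
    and m: "0 < m" "m \<le> M" "2 * M \<le> n"
  obtains loss :: "unit tree \<Rightarrow> real" where
    "\<And>t. loss t \<ge> 0"
    "\<And>t. fringe_sum (\<lambda>s. of_bool (m < size s \<and> size s \<le> M)) t - loss t \<le> real (num_unordered t)"
    "expect n loss \<le> 4 * (real n + 1) * C / real m + 2 * (real n * (real n + 1)) * 2 powr (- (1 + d) * real m)"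
proof -
  define window where "window s \<longleftrightarrow> m < size s \<and> size s \<le> M" for s :: "unit tree"
  define rare where "rare s \<longleftrightarrow> fringe_sum sym_toll s < d * real (size s)" for s :: "unit tree"
  define A where "A = {s. window s \<and> \<not> rare s}"
  define U where "U = shape ` A"
  define N where "N u = fringe_sum (\<lambda>s :: unit tree. of_bool (s \<noteq> Leaf \<and> shape s = u))" for u
  define bad where "bad s = (of_bool (window s \<and> rare s) :: real)" for s
  define loss where "loss t = fringe_sum bad t + (\<Sum>u\<in>U. (N u t)\<^sup>2 - N u t)" for t
  define r :: real where "r = 2 powr (- (1 + d) * real m)"
  have cat: "(\<Sum>i\<in>{m<..M}. catalan_gf $ i) \<le> 2"
  proof -
    have "central (Suc m) \<le> 1" using central_decseq[of 0 "Suc m"] by simp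
    then show ?thesis using sum_catalan_gf[OF m(2)] central_pos[of "Suc M"] by simp
  qed
  have cat0: "catalan_gf $ i \<ge> 0" for i
    using central_pos[of i] by (simp add: catalan_gf_nth')
  have fin: "finite A" by (rule finite_subset[OF _ finite_size_le[of M]]) (auto simp: A_def window_def)
  \<comment> \<open>A is a union of full shape classes, so the weight of A within a class is the
    whole P(T).\<close>
  have inv: "s \<in> A" if "shape s = shape t" "t \<in> A" for s t
    using that shape_eqD(1,2)[OF that(1)] by (simp add: A_def window_def rare_def fringe_sum_sym_toll)
  have Leaf: "s \<noteq> Leaf" if "s \<in> A" for s using that by (auto simp: A_def window_def)
  have "fringe_sum (\<lambda>s. of_bool (m < size s \<and> size s \<le> M)) t = (\<Sum>u\<in>U. N u t) + fringe_sum bad t" for t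
  proof -
    have "of_bool (m < size s \<and> size s \<le> M) = (\<Sum>u\<in>U. of_bool (s \<noteq> Leaf \<and> shape s = u)) + bad s" for s
    proof -
      have "(\<Sum>u\<in>U. of_bool (s \<noteq> Leaf \<and> shape s = u)) = (\<Sum>u\<in>U. if u = shape s then of_bool (s \<noteq> Leaf) else 0 :: real)"
        by (rule sum.cong) auto
      also have "\<dots> = of_bool (s \<in> A)"
        using fin inv[of s] Leaf by (auto simp: U_def sum.delta)
      finally show ?thesis by (auto simp: A_def bad_def window_def)
    qed
    note window_eq = this
    have "finite U" using fin by (simp add: U_def)
    show ?thesis
      unfolding window_eq fringe_sum_add fringe_sum_sum[OF \<open>finite U\<close>] N_def by (rule refl)
  qed
  then have 1: "fringe_sum (\<lambda>s. of_bool (m < size s \<and> size s \<le> M)) t - loss t \<le> real (num_unordered t)" for t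
    using num_unordered_ge[of U t] fin unfolding loss_def N_def by (simp add: U_def)
  have "(N u t)\<^sup>2 - N u t \<ge> 0" for u t
    using fringe_sum_of_bool_cases[of "\<lambda>s. s \<noteq> Leaf \<and> shape s = u" t] by (auto simp: N_def power2_eq_square)
  then have 2: "loss t \<ge> 0" for t
    unfolding loss_def by (intro add_nonneg_nonneg fringe_sum_nonneg sum_nonneg) (auto simp: bad_def)
  have gf_bad: "tree_gf bad $ i \<le> (if m < i \<and> i \<le> M then catalan_gf $ i * (C / real m) else 0)" for i
  proof -
    have "tree_gf bad $ i = (if m < i \<and> i \<le> M then tree_gf (\<lambda>t. of_bool (rare t)) $ i else 0)"
      unfolding bad_def window_def by (rule tree_gf_size)
    moreover have "tree_gf (\<lambda>t. of_bool (rare t)) $ i = catalan_gf $ i * expect i (\<lambda>t. of_bool (rare t))"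
      unfolding expect_eq catalan_gf_nth' using central_pos[of i] by simp
    moreover have "catalan_gf $ i * expect i (\<lambda>t. of_bool (rare t)) \<le> catalan_gf $ i * (C / real m)" if "m < i"
    proof (rule mult_left_mono[OF _ cat0])
      have "C / real i \<le> C / real m" using that m(1) C(2) by (intro divide_left_mono) auto
      then show "expect i (\<lambda>t. of_bool (rare t)) \<le> C / real m"
        using C(1)[of i] unfolding rare_def by linarith
    qed
    ultimately show ?thesis by simp
  qed
  have "expect n (fringe_sum bad) \<le> 2 * (real n + 1) * (\<Sum>i\<le>M. tree_gf bad $ i)"
    by (rule expect_fringe_sum_le) (use m in \<open>auto simp: bad_def window_def\<close>)
  also have "\<dots> \<le> 2 * (real n + 1) * (2 * (C / real m))"
  proof (rule mult_left_mono)
    have "(\<Sum>i\<le>M. tree_gf bad $ i) \<le> (\<Sum>i\<le>M. if m < i \<and> i \<le> M then catalan_gf $ i * (C / real m) else 0)"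
      by (rule sum_mono) (rule gf_bad)
    also have "\<dots> = (\<Sum>i\<in>{m<..M}. catalan_gf $ i * (C / real m))"
      by (rule sum.mono_neutral_cong_right) auto
    also have "\<dots> \<le> 2 * (C / real m)"
      unfolding sum_distrib_right[symmetric] using cat C(2) by (intro mult_right_mono) auto
    finally show "(\<Sum>i\<le>M. tree_gf bad $ i) \<le> 2 * (C / real m)" .
  qed simp
  also have "2 * (real n + 1) * (2 * (C / real m)) = 4 * (real n + 1) * C / real m" by simp
  finally have bad: "expect n (fringe_sum bad) \<le> 4 * (real n + 1) * C / real m" .
  define p where "p u = (\<Sum>s\<in>{s \<in> A. shape s = u}. 1 / 4 ^ size s :: real)" for u
  have "(\<Sum>u\<in>U. p u) = (\<Sum>s\<in>A. 1 / 4 ^ size s)"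
    unfolding p_def U_def by (rule sum.image_gen[OF fin, symmetric])
  also have "\<dots> \<le> (\<Sum>s\<in>(\<Union>i\<in>{m<..M}. binary_trees i). 1 / 4 ^ size s)"
    by (rule sum_mono2) (auto simp: finite_binary_trees A_def window_def, auto simp: binary_trees_def)
  also have "\<dots> = (\<Sum>i\<in>{m<..M}. \<Sum>s\<in>binary_trees i. 1 / 4 ^ size s)"
    by (rule sum.UNION_disjoint) (simp_all add: finite_binary_trees, auto simp: binary_trees_def)
  also have "\<dots> = (\<Sum>i\<in>{m<..M}. catalan_gf $ i)"
    by (rule sum.cong) (auto simp: catalan_gf_def tree_gf_nth binary_trees_def)
  finally have sum_p: "(\<Sum>u\<in>U. p u) \<le> 2" using cat by linarith
  have pair: "expect n (\<lambda>t. (N u t)\<^sup>2 - N u t) \<le> real n * (real n + 1) * (p u * r)" if "u \<in> U" for u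
  proof -
    obtain s where s: "s \<in> A" "u = shape s" using \<open>u \<in> U\<close> by (auto simp: U_def)
    have cls: "{s' \<in> A. shape s' = u} = shape_class s" "{s'. s' \<noteq> Leaf \<and> shape s' = u} = shape_class s"
      using inv[OF _ s(1)] s Leaf by (auto simp: shape_class_def)
    have sz: "size s' = size s" if "s' \<in> shape_class s" for s'
      using that unfolding shape_class_def by (intro shape_eqD(1)) simp
    then have p: "p u = 2 ^ asym_count s / 4 ^ size s"
      unfolding p_def cls(1) by (simp add: card_shape_class)
    have "p u \<le> r" unfolding p r_def
      by (rule shape_probability_le) (use s d in \<open>auto simp: A_def window_def rare_def\<close>)
    have "expect n (\<lambda>t. (fringe_sum (\<lambda>s'. of_bool (s' \<in> shape_class s)) t)\<^sup>2 - fringe_sum (\<lambda>s'. of_bool (s' \<in> shape_class s)) t)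
        \<le> real n * (real n + 1) * (real (card (shape_class s)) / 4 ^ size s)\<^sup>2"
      by (rule expect_same_size_pairs) (use sz s(1) in \<open>auto simp: A_def window_def\<close>)
    also have "fringe_sum (\<lambda>s'. of_bool (s' \<in> shape_class s)) = N u"
      unfolding N_def cls(2)[symmetric] by simp
    also have "real (card (shape_class s)) / 4 ^ size s = p u"
      by (simp add: p card_shape_class)
    also have "(p u)\<^sup>2 \<le> p u * r"
      unfolding power2_eq_square using \<open>p u \<le> r\<close> by (intro mult_left_mono) (simp_all add: p)
    finally show ?thesis by (simp add: mult_left_mono)
  qed
  have "expect n (\<lambda>t. \<Sum>u\<in>U. (N u t)\<^sup>2 - N u t) \<le> (\<Sum>u\<in>U. real n * (real n + 1) * (p u * r))"
    unfolding expect_sum by (rule sum_mono) (rule pair)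
  also have "\<dots> = (\<Sum>u\<in>U. (real n * (real n + 1) * r) * p u)"
    by (simp only: mult_ac)
  also have "\<dots> = real n * (real n + 1) * r * (\<Sum>u\<in>U. p u)"
    by (rule sum_distrib_left[symmetric])
  also have "\<dots> \<le> real n * (real n + 1) * r * 2"
    by (intro mult_left_mono sum_p) (simp add: r_def)
  finally have "expect n loss \<le> 4 * (real n + 1) * C / real m + 2 * (real n * (real n + 1)) * r"
    using bad unfolding loss_def expect_add by simp
  then show ?thesis using that[of loss] 1 2 unfolding r_def by blast
qed

section \<open>Asymptotics\<close>

text \<open>\<open>(central n)\<^sup>2 * (2 * real n + 1)\<close> is the reciprocal of a partial
  product of Wallis.\<close>

lemma central_asymptotics: "(\<lambda>n. central n * sqrt (real n)) \<longlonglongrightarrow> 1 / sqrt pi"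
proof -
  have eq: "(\<Prod>k=1..n. (4 * real k ^ 2) / (4 * real k ^ 2 - 1)) = 1 / ((central n)\<^sup>2 * (2 * real n + 1))" for n
  proof (induction n)
    case (Suc n)
    have "(4 * real (Suc n) ^ 2) / (4 * real (Suc n) ^ 2 - 1) = (2 * real n + 2)\<^sup>2 / ((2 * real n + 1) * (2 * real n + 3))"
      by (rule arg_cong2[of _ _ _ _ "(/)"]) (simp_all add: power2_eq_square algebra_simps)
    then show ?case using Suc central_pos[of n]
      by (simp add: central_Suc power2_eq_square field_simps)
  qed simp
  have "(\<lambda>n. 1 / ((central n)\<^sup>2 * (2 * real n + 1))) \<longlonglongrightarrow> pi / 2"
    using wallis unfolding eq .
  then have "(\<lambda>n. inverse (1 / ((central n)\<^sup>2 * (2 * real n + 1)))) \<longlonglongrightarrow> inverse (pi / 2)"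
    by (rule tendsto_inverse) simp
  moreover have "(\<lambda>n. real n / (2 * real n + 1)) \<longlonglongrightarrow> 1 / 2" by real_asymp
  ultimately have "(\<lambda>n. sqrt (inverse (1 / ((central n)\<^sup>2 * (2 * real n + 1))) * (real n / (2 * real n + 1))))
      \<longlonglongrightarrow> sqrt (inverse (pi / 2) * (1 / 2))"
    by (intro tendsto_real_sqrt tendsto_mult)
  moreover have "sqrt (inverse (1 / ((central n)\<^sup>2 * (2 * real n + 1))) * (real n / (2 * real n + 1))) = central n * sqrt (real n)" for n
    using central_pos[of n] by (simp add: real_sqrt_mult real_sqrt_divide)
  ultimately show ?thesis by (simp add: real_sqrt_divide)
qed

lemma central_log_asymptotics:
  assumes "filterlim k at_top sequentially" "(\<lambda>n. ln (real n) / real (k n)) \<longlonglongrightarrow> l"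
  shows "(\<lambda>n. central (k n) * sqrt (ln (real n))) \<longlonglongrightarrow> sqrt (l / pi)"
proof -
  have "(\<lambda>n. (central (k n) * sqrt (real (k n))) * sqrt (ln (real n) / real (k n))) \<longlonglongrightarrow> 1 / sqrt pi * sqrt l"
    by (intro tendsto_mult tendsto_real_sqrt assms filterlim_compose[OF central_asymptotics])
  moreover have "\<forall>\<^sub>F n in sequentially. (central (k n) * sqrt (real (k n))) * sqrt (ln (real n) / real (k n)) = central (k n) * sqrt (ln (real n))"
    using eventually_compose_filterlim[OF eventually_gt_at_top[of 0] assms(1)]
    by eventually_elim (simp add: real_sqrt_divide)
  ultimately have "(\<lambda>n. central (k n) * sqrt (ln (real n))) \<longlonglongrightarrow> 1 / sqrt pi * sqrt l"
    by (rule Lim_transform_eventually)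
  then show ?thesis by (simp add: real_sqrt_divide)
qed

text \<open>The successors come from the telescoped weight of a range of sizes. The limit 0 for the
  square says that the upper end of the window is negligible.\<close>

lemma log_scale_asymptotics:
  fixes c :: real
  assumes "c > 0" "(\<lambda>n. real (k n) / ln (real n)) \<longlonglongrightarrow> 1 / c"
  shows "filterlim k at_top sequentially" "(\<lambda>n. ln (real n) / real (Suc (k n))) \<longlonglongrightarrow> c"
    "(\<lambda>n. ln (real n) / real (Suc ((k n)\<^sup>2))) \<longlonglongrightarrow> 0"
proof -
  have pos: "\<forall>\<^sub>F n in sequentially. ln (real n) > 0" by real_asymp
  have "filterlim (\<lambda>n. (real (k n) / ln (real n)) * ln (real n)) at_top sequentially"
    by (rule filterlim_tendsto_pos_mult_at_top[OF assms(2)]) (use assms(1) in simp, real_asymp)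
  moreover have "\<forall>\<^sub>F n in sequentially. (real (k n) / ln (real n)) * ln (real n) = real (k n)"
    using pos by eventually_elim simp
  ultimately have "filterlim (\<lambda>n. real (k n)) at_top sequentially"
    by (rule filterlim_mono_eventually[OF _ order_refl order_refl])
  then show top: "filterlim k at_top sequentially"
    by (simp add: filterlim_sequentially_iff_filterlim_real)
  have "(\<lambda>n. real (k n) / ln (real n) + 1 / ln (real n)) \<longlonglongrightarrow> 1 / c + 0"
    by (intro tendsto_add assms) real_asymp
  then have "(\<lambda>n. inverse (real (k n) / ln (real n) + 1 / ln (real n))) \<longlonglongrightarrow> inverse (1 / c + 0)"
    by (rule tendsto_inverse) (use assms(1) in simp)
  moreover have "inverse (real (k n) / ln (real n) + 1 / ln (real n)) = ln (real n) / real (Suc (k n))" for n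
    by (simp add: add_divide_distrib[symmetric] add.commute)
  ultimately show lim: "(\<lambda>n. ln (real n) / real (Suc (k n))) \<longlonglongrightarrow> c" by simp
  have "(\<lambda>x::nat. real (Suc x) / real (Suc (x\<^sup>2))) \<longlonglongrightarrow> 0" by real_asymp
  from tendsto_mult[OF lim filterlim_compose[OF this top]]
  show "(\<lambda>n. ln (real n) / real (Suc ((k n)\<^sup>2))) \<longlonglongrightarrow> 0" by (simp del: of_nat_Suc)
qed

lemma log_ceiling_asymptotics:
  fixes c :: real
  assumes "c > 0"
  shows "(\<lambda>n. real (nat \<lceil>ln (real n) / c\<rceil>) / ln (real n)) \<longlonglongrightarrow> 1 / c"
proof (rule real_tendsto_sandwich[of "\<lambda>_. 1 / c" _ _ "\<lambda>n. 1 / c + 1 / ln (real n)"])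
  show "(\<lambda>n. 1 / c + 1 / ln (real n)) \<longlonglongrightarrow> 1 / c" by real_asymp
  have "\<forall>\<^sub>F n in sequentially. ln (real n) > 0" by real_asymp
  then show "\<forall>\<^sub>F n in sequentially. 1 / c \<le> real (nat \<lceil>ln (real n) / c\<rceil>) / ln (real n)"
  proof eventually_elim
    case (elim n)
    have "ln (real n) / c \<le> real (nat \<lceil>ln (real n) / c\<rceil>)" by (rule real_nat_ceiling_ge)
    then show ?case using elim assms by (simp add: field_simps)
  qed
  have "\<forall>\<^sub>F n in sequentially. ln (real n) > 0" by real_asymp
  then show "\<forall>\<^sub>F n in sequentially. real (nat \<lceil>ln (real n) / c\<rceil>) / ln (real n) \<le> 1 / c + 1 / ln (real n)"
  proof eventually_elim
    case (elim n)
    then have "ln (real n) / c > 0" using assms by simp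
    then have "real (nat \<lceil>ln (real n) / c\<rceil>) \<le> ln (real n) / c + 1" by linarith
    then have "real (nat \<lceil>ln (real n) / c\<rceil>) / ln (real n) \<le> (ln (real n) / c + 1) / ln (real n)"
      using elim by (intro divide_right_mono) auto
    then show ?case using elim by (simp add: add_divide_distrib)
  qed
qed simp

lemma log_floor_asymptotics:
  fixes c :: real
  assumes "c > 0"
  shows "(\<lambda>n. real (nat \<lfloor>ln (real n) / c\<rfloor>) / ln (real n)) \<longlonglongrightarrow> 1 / c"
proof (rule real_tendsto_sandwich[of "\<lambda>n. 1 / c - 1 / ln (real n)" _ _ "\<lambda>_. 1 / c"])
  show "(\<lambda>n. 1 / c - 1 / ln (real n)) \<longlonglongrightarrow> 1 / c" by real_asymp
  have "\<forall>\<^sub>F n in sequentially. ln (real n) > 0" by real_asymp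
  then show "\<forall>\<^sub>F n in sequentially. real (nat \<lfloor>ln (real n) / c\<rfloor>) / ln (real n) \<le> 1 / c"
  proof eventually_elim
    case (elim n)
    then have "ln (real n) / c > 0" using assms by simp
    then have "real (nat \<lfloor>ln (real n) / c\<rfloor>) \<le> ln (real n) / c" by linarith
    then have "real (nat \<lfloor>ln (real n) / c\<rfloor>) / ln (real n) \<le> ln (real n) / c / ln (real n)"
      using elim by (intro divide_right_mono) auto
    then show ?case using elim by simp
  qed
  have "\<forall>\<^sub>F n in sequentially. ln (real n) > 0" by real_asymp
  then show "\<forall>\<^sub>F n in sequentially. 1 / c - 1 / ln (real n) \<le> real (nat \<lfloor>ln (real n) / c\<rfloor>) / ln (real n)"
  proof eventually_elim
    case (elim n)
    have "ln (real n) / c - 1 \<le> real (nat \<lfloor>ln (real n) / c\<rfloor>)" by linarith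
    then have "(ln (real n) / c - 1) / ln (real n) \<le> real (nat \<lfloor>ln (real n) / c\<rfloor>) / ln (real n)"
      using elim by (intro divide_right_mono) auto
    then show ?case using elim by (simp add: diff_divide_distrib)
  qed
qed simp

section \<open>The number of shapes on the scale n / sqrt(log n)\<close>

definition log_scale :: "nat \<Rightarrow> real" where
  "log_scale n = real n / sqrt (ln (real n))"

lemma eventually_log_scale_pos: "\<forall>\<^sub>F n in sequentially. log_scale n > 0"
  unfolding log_scale_def by real_asymp

lemma prob_tree_not:
  "measure_pmf.prob (random_binary_tree n) {t. \<not> P t} = 1 - measure_pmf.prob (random_binary_tree n) {t. P t}"
  using measure_pmf.prob_compl[of "{t. P t}" "random_binary_tree n"]
  by (simp add: Compl_eq_Diff_UNIV[symmetric] Collect_neg_eq)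

lemma prob_tree_le_1_minus:
  assumes "\<And>t. size t = n \<Longrightarrow> \<not> P t \<Longrightarrow> Q t \<or> R t"
  shows "1 - measure_pmf.prob (random_binary_tree n) {t. Q t} - measure_pmf.prob (random_binary_tree n) {t. R t}
    \<le> measure_pmf.prob (random_binary_tree n) {t. P t}"
proof -
  let ?p = "measure_pmf.prob (random_binary_tree n)"
  have "?p {t. \<not> P t} \<le> ?p ({t. Q t} \<union> {t. R t})"
    using assms by (intro measure_pmf.finite_measure_mono_AE) (auto simp: AE_measure_pmf_iff set_random_binary_tree binary_trees_def)
  also have "\<dots> \<le> ?p {t. Q t} + ?p {t. R t}"
    by (rule measure_Un_le) auto
  finally show ?thesis by (simp add: prob_tree_not)
qed

text \<open>The window starts at k = log n / \<kappa>, rounded up. As \<kappa> < (1 + d) ln 2 for a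
  suitable d, a typical shape in it has probability at most n^(-1-\<epsilon>), so repetitions cost
  O(n^(1-\<epsilon>)) in the mean; atypical trees cost O(n / log n). Both are of smaller order than
  the scale.\<close>

lemma num_unordered_lower_tail:
  fixes c \<kappa> :: real
  assumes \<kappa>: "0 < \<kappa>" "\<kappa> < ln 2 * (1 + shape_sum (1/16) 2 h / 4)" and c: "c < 2 * sqrt (\<kappa> / pi)"
  shows "(\<lambda>n. measure_pmf.prob (random_binary_tree n) {t. c * log_scale n \<le> real (num_unordered t)}) \<longlonglongrightarrow> 1"
proof -
  have "max 0 (\<kappa> / ln 2 - 1) < shape_sum (1/16) 2 h / 4"
  proof -
    have "\<kappa> / ln 2 < 1 + shape_sum (1/16) 2 h / 4"
      using \<kappa>(2) by (simp add: pos_divide_less_eq mult.commute)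
    then show ?thesis unfolding max_less_iff_conj using shape_sum_ge_1[of "1/16" 2 h] by linarith
  qed
  then obtain d where d: "max 0 (\<kappa> / ln 2 - 1) < d" "d < shape_sum (1/16) 2 h / 4"
    using dense by blast
  obtain C where C: "\<And>n. expect n (\<lambda>t. of_bool (fringe_sum sym_toll t < d * real (size t))) \<le> C / real n" "C \<ge> 0"
    using expect_few_symmetric[OF d(2)] by blast
  \<comment> \<open>The gap between c and c' absorbs the loss, through Markov's inequality.\<close>
  obtain c' where c': "c < c'" "c' < 2 * sqrt (\<kappa> / pi)" using dense[OF c] by blast
  define \<epsilon> where "\<epsilon> = ln 2 * (1 + d) / \<kappa> - 1"
  have \<epsilon>: "\<epsilon> > 0" using d \<kappa> by (simp add: \<epsilon>_def field_simps)
  define k where "k n = nat \<lceil>ln (real n) / \<kappa>\<rceil>" for n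
  have k: "(\<lambda>n. real (k n) / ln (real n)) \<longlonglongrightarrow> 1 / \<kappa>"
    unfolding k_def by (rule log_ceiling_asymptotics[OF \<kappa>(1)])
  note k_lims = log_scale_asymptotics[OF \<kappa>(1) k]
  \<comment> \<open>The deviation n^(3/4) exceeds the standard deviation, of order k sqrt(n), and is
    still negligible against n / sqrt(log n).\<close>
  define G where "G n = (real n + 1) * (2 * (central (Suc (k n)) - central (Suc ((k n)\<^sup>2)))) - real n powr (3/4)" for n
  define L where "L n = 4 * (real n + 1) * C / real (k n) + 2 * (real n * (real n + 1)) * 2 powr (- (1 + d) * real (k n))" for n
  have top2: "filterlim (\<lambda>n. Suc ((k n)\<^sup>2)) at_top sequentially"
  proof -
    have "filterlim (\<lambda>x::nat. Suc (x\<^sup>2)) at_top sequentially"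
      by (rule filterlim_at_top_mono[OF filterlim_ident]) (simp add: power2_eq_square le_SucI)
    from filterlim_compose[OF this k_lims(1)] show ?thesis .
  qed
  have G: "(\<lambda>n. G n / log_scale n) \<longlonglongrightarrow> 2 * sqrt (\<kappa> / pi)"
  proof -
    have "(\<lambda>n. (real n + 1) / real n * (2 * (central (Suc (k n)) * sqrt (ln (real n)) - central (Suc ((k n)\<^sup>2)) * sqrt (ln (real n))))
        - real n powr (-1/4) * sqrt (ln (real n))) \<longlonglongrightarrow> 1 * (2 * (sqrt (\<kappa> / pi) - sqrt (0 / pi))) - 0"
    proof (intro tendsto_diff tendsto_mult tendsto_const central_log_asymptotics)
      show "(\<lambda>n. (real n + 1) / real n) \<longlonglongrightarrow> 1" by real_asymp
      show "filterlim (\<lambda>n. Suc (k n)) at_top sequentially"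
        by (rule filterlim_compose[OF filterlim_Suc k_lims(1)])
      show "(\<lambda>n. real n powr (-1/4) * sqrt (ln (real n))) \<longlonglongrightarrow> 0" by real_asymp
    qed (rule k_lims top2)+
    moreover have "\<forall>\<^sub>F n in sequentially. (real n + 1) / real n * (2 * (central (Suc (k n)) * sqrt (ln (real n)) - central (Suc ((k n)\<^sup>2)) * sqrt (ln (real n))))
        - real n powr (-1/4) * sqrt (ln (real n)) = G n / log_scale n"
      using eventually_gt_at_top[of 1]
    proof eventually_elim
      case (elim n)
      have p: "real n powr (3/4) = real n powr (-1/4) * real n"
        using elim powr_add[of "real n" "-1/4" 1] by simp
      show ?case using elim unfolding G_def log_scale_def p
        by (simp add: field_simps)
    qed
    ultimately show ?thesis by (simp add: Lim_transform_eventually)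
  qed
  have L: "(\<lambda>n. L n / log_scale n) \<longlonglongrightarrow> 0"
  proof -
    define L' where "L' n = 4 * C * ((real n + 1) / real n) * ((real (k n) / ln (real n)) powr (-1) * (1 / sqrt (ln (real n))))
       + 2 * (real n + 1) * sqrt (ln (real n)) * real n powr (- (1 + \<epsilon>))" for n
    have "L' \<longlonglongrightarrow> 4 * C * 1 * ((1 / \<kappa>) powr (-1) * 0) + 0"
      unfolding L'_def
    proof (intro tendsto_add tendsto_mult tendsto_const tendsto_powr k)
      show "(\<lambda>n. (real n + 1) / real n) \<longlonglongrightarrow> 1" by real_asymp
      show "(\<lambda>n. 1 / sqrt (ln (real n))) \<longlonglongrightarrow> 0" by real_asymp
      show "(\<lambda>n. 2 * (real n + 1) * sqrt (ln (real n)) * real n powr (- (1 + \<epsilon>))) \<longlonglongrightarrow> 0"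
        using \<epsilon> by real_asymp
    qed (use \<kappa> in simp)
    then have lim': "L' \<longlonglongrightarrow> 0" by simp
    have "\<forall>\<^sub>F n in sequentially. L n / log_scale n \<le> L' n"
      using eventually_gt_at_top[of 1] eventually_compose_filterlim[OF eventually_gt_at_top[of 0] k_lims(1)]
    proof eventually_elim
      case (elim n)
      then have ln: "ln (real n) > 0" by simp
      have "ln (real n) / \<kappa> \<le> real (k n)" unfolding k_def by (rule real_nat_ceiling_ge)
      then have "(1 + d) * ln 2 * (ln (real n) / \<kappa>) \<le> (1 + d) * ln 2 * real (k n)"
        using d by (intro mult_left_mono) auto
      moreover have "(1 + d) * ln 2 * (ln (real n) / \<kappa>) = (1 + \<epsilon>) * ln (real n)"
        by (simp add: \<epsilon>_def)
      ultimately have "(1 + \<epsilon>) * ln (real n) \<le> (1 + d) * real (k n) * ln 2"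
        by (simp only: mult_ac)
      then have "(- (1 + d) * real (k n)) * ln 2 \<le> (- (1 + \<epsilon>)) * ln (real n)"
        by (simp only: mult_minus_left neg_le_iff_le)
      then have "2 powr (- (1 + d) * real (k n)) \<le> real n powr (- (1 + \<epsilon>))"
        using elim unfolding powr_def by simp
      then have "2 * (real n + 1) * sqrt (ln (real n)) * 2 powr (- (1 + d) * real (k n))
          \<le> 2 * (real n + 1) * sqrt (ln (real n)) * real n powr (- (1 + \<epsilon>))"
        using ln by (intro mult_left_mono) auto
      moreover have "4 * (real n + 1) * C / real (k n) / log_scale n =
          4 * C * ((real n + 1) / real n) * ((real (k n) / ln (real n)) powr (-1) * (1 / sqrt (ln (real n))))"
      proof -
        have "(real (k n) / ln (real n)) powr (-1) * (1 / sqrt (ln (real n))) = ln (real n) / (real (k n) * sqrt (ln (real n)))"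
          using ln elim by (simp add: powr_minus)
        also have "\<dots> = sqrt (ln (real n)) / real (k n)"
          using ln elim by (simp add: field_simps)
        finally have eq: "(real (k n) / ln (real n)) powr (-1) * (1 / sqrt (ln (real n))) = sqrt (ln (real n)) / real (k n)" .
        show ?thesis unfolding eq log_scale_def by (simp add: field_simps)
      qed
      moreover have "2 * (real n * (real n + 1)) * 2 powr (- (1 + d) * real (k n)) / log_scale n
          = 2 * (real n + 1) * sqrt (ln (real n)) * 2 powr (- (1 + d) * real (k n))"
        using elim ln by (simp add: log_scale_def field_simps)
      ultimately show ?case unfolding L_def L'_def add_divide_distrib by linarith
    qed
    moreover have "\<forall>\<^sub>F n in sequentially. 0 \<le> L n / log_scale n"
      using eventually_log_scale_pos by eventually_elim (simp add: L_def C)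
    ultimately show ?thesis
      by (rule real_tendsto_sandwich[OF _ _ tendsto_const lim', rotated])
  qed
  define \<eta> where "\<eta> = c' - c"
  define b where "b n = 1 - 2 * real ((k n)\<^sup>2) * real n / (real n powr (3/4))\<^sup>2 - L n / log_scale n / \<eta>" for n
  have \<eta>: "\<eta> > 0" using c' by (simp add: \<eta>_def)
  have "b \<longlonglongrightarrow> 1 - 0 - 0 / \<eta>"
    unfolding b_def
  proof (intro tendsto_diff tendsto_const tendsto_divide L)
    have "(\<lambda>n. 2 * (real (k n) / ln (real n))\<^sup>2 * ((ln (real n))\<^sup>2 / sqrt (real n))) \<longlonglongrightarrow> 2 * (1 / \<kappa>)\<^sup>2 * 0"
    proof (intro tendsto_mult tendsto_power tendsto_const k)
      show "(\<lambda>n. (ln (real n))\<^sup>2 / sqrt (real n)) \<longlonglongrightarrow> 0" by real_asymp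
    qed
    moreover have "\<forall>\<^sub>F n in sequentially. 2 * (real (k n) / ln (real n))\<^sup>2 * ((ln (real n))\<^sup>2 / sqrt (real n))
        = 2 * real ((k n)\<^sup>2) * real n / (real n powr (3/4))\<^sup>2"
      using eventually_gt_at_top[of 1]
    proof eventually_elim
      case (elim n)
      have "(real n powr (3/4))\<^sup>2 = real n powr (3/2)"
        by (simp flip: powr_add add: power2_eq_square)
      also have "\<dots> = real n powr (1/2) * real n"
        using elim powr_add[of "real n" "1/2" 1] by simp
      also have "\<dots> = sqrt (real n) * real n" using elim by (simp add: powr_half_sqrt)
      finally show ?case using elim by (simp add: power_divide)
    qed
    ultimately show "(\<lambda>n. 2 * real ((k n)\<^sup>2) * real n / (real n powr (3/4))\<^sup>2) \<longlonglongrightarrow> 0"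
      by (simp add: Lim_transform_eventually)
  qed (use \<eta> in simp)
  then have b: "b \<longlonglongrightarrow> 1" by simp
  have k_sq: "\<forall>\<^sub>F n in sequentially. 2 * real ((k n)\<^sup>2) \<le> real n"
  proof -
    have "(\<lambda>n. (real (k n) / ln (real n))\<^sup>2 * (2 * (ln (real n))\<^sup>2 / real n)) \<longlonglongrightarrow> (1 / \<kappa>)\<^sup>2 * 0"
    proof (intro tendsto_mult tendsto_power tendsto_const k)
      show "(\<lambda>n. 2 * (ln (real n))\<^sup>2 / real n) \<longlonglongrightarrow> 0" by real_asymp
    qed
    then have "\<forall>\<^sub>F n in sequentially. (real (k n) / ln (real n))\<^sup>2 * (2 * (ln (real n))\<^sup>2 / real n) < 1"
      by (intro order_tendstoD(2)) auto
    then show ?thesis using eventually_gt_at_top[of 1]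
      by eventually_elim (simp add: power_divide field_simps)
  qed
  have "\<forall>\<^sub>F n in sequentially. b n \<le> measure_pmf.prob (random_binary_tree n) {t. c * log_scale n \<le> real (num_unordered t)}"
    using eventually_gt_at_top[of 1] eventually_compose_filterlim[OF eventually_gt_at_top[of 0] k_lims(1)]
      k_sq order_tendstoD(1)[OF G c'(2)] eventually_log_scale_pos
  proof eventually_elim
    case (elim n)
    have d0: "0 \<le> d" using d(1) by simp
    let ?F = "fringe_sum (\<lambda>s. of_bool (k n < size s \<and> size s \<le> (k n)\<^sup>2))"
    let ?\<phi> = "\<Sum>i\<le>n. tree_gf (\<lambda>s. of_bool (k n < size s \<and> size s \<le> (k n)\<^sup>2)) $ i"
    have le: "k n \<le> (k n)\<^sup>2" "2 * (k n)\<^sup>2 \<le> n"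
    proof -
      show "k n \<le> (k n)\<^sup>2" by (simp add: power2_eq_square)
      show "2 * (k n)\<^sup>2 \<le> n" using elim(3) by (metis of_nat_le_iff of_nat_mult of_nat_numeral)
    qed
    obtain loss where loss: "\<And>t. loss t \<ge> 0" "\<And>t. ?F t - loss t \<le> real (num_unordered t)" "expect n loss \<le> L n"
      unfolding L_def by (rule num_unordered_window[OF d0 C elim(2) le]) blast
    have \<phi>: "(real n + 1) * ?\<phi> - real n powr (3/4) = G n"
      using sum_tree_gf_window[OF le(1), of n] le(2) by (simp add: G_def)
    have F: "measure_pmf.prob (random_binary_tree n) {t. ?F t \<le> G n} \<le> 2 * real ((k n)\<^sup>2) * real n / (real n powr (3/4))\<^sup>2"
      unfolding \<phi>[symmetric] using elim(1) by (intro prob_fringe_sum_less) auto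
    have "measure_pmf.prob (random_binary_tree n) {t. loss t \<ge> \<eta> * log_scale n} \<le> expect n loss / (\<eta> * log_scale n)"
      using elim \<eta> loss(1) by (intro prob_tree_markov) auto
    also have "\<dots> \<le> L n / (\<eta> * log_scale n)"
      using elim \<eta> loss(3) by (intro divide_right_mono) auto
    finally have M: "measure_pmf.prob (random_binary_tree n) {t. loss t \<ge> \<eta> * log_scale n} \<le> L n / log_scale n / \<eta>"
      by (simp add: mult.commute)
    have "c' * log_scale n \<le> G n" using elim by (simp add: field_simps)
    then have "?F t \<le> G n \<or> loss t \<ge> \<eta> * log_scale n" if "\<not> c * log_scale n \<le> real (num_unordered t)" for t
      using loss(2)[of t] that unfolding \<eta>_def left_diff_distrib by linarith
    then have "1 - measure_pmf.prob (random_binary_tree n) {t. ?F t \<le> G n} - measure_pmf.prob (random_binary_tree n) {t. loss t \<ge> \<eta> * log_scale n}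
       \<le> measure_pmf.prob (random_binary_tree n) {t. c * log_scale n \<le> real (num_unordered t)}"
      by (rule prob_tree_le_1_minus)
    then show ?case using F M unfolding b_def by linarith
  qed
  then show ?thesis
    by (rule real_tendsto_sandwich[OF _ _ b tendsto_const]) simp
qed

text \<open>Markov's inequality read backwards: the mean is at least c' times the scale times a
  probability that eventually exceeds c / c'.\<close>

lemma num_unordered_lower_mean:
  fixes c c' :: real
  assumes "c < c'" "0 \<le> c"
    and lim: "(\<lambda>n. measure_pmf.prob (random_binary_tree n) {t. c' * log_scale n \<le> real (num_unordered t)}) \<longlonglongrightarrow> 1"
  shows "\<forall>\<^sub>F n in sequentially. c * log_scale n \<le> expect n (\<lambda>t. real (num_unordered t))"
proof -
  have "c / c' < 1" using assms by simp
  from order_tendstoD(1)[OF lim this] eventually_log_scale_pos show ?thesis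
  proof eventually_elim
    case (elim n)
    have pos: "c' * log_scale n > 0" using assms elim by simp
    have "c / c' * (c' * log_scale n) \<le> measure_pmf.prob (random_binary_tree n) {t. c' * log_scale n \<le> real (num_unordered t)} * (c' * log_scale n)"
      using elim pos by (intro mult_right_mono) auto
    also have "\<dots> \<le> expect n (\<lambda>t. real (num_unordered t))"
      using prob_tree_markov[of "\<lambda>t. real (num_unordered t)" "c' * log_scale n" n] pos by (simp add: pos_le_divide_eq)
    finally show ?case using assms by simp
  qed
qed

text \<open>With k = log n / \<kappa> rounded down and \<kappa> > ln (1/x), the shapes of size at
  most k number at most B n^a with a < 1, so the large fringe subtrees dominate.\<close>

lemma num_unordered_upper:
  fixes c \<kappa> x :: real
  assumes B: "\<And>h. shape_sum x (1/2) h \<le> B" and x: "0 < x" "x \<le> 1"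
    and \<kappa>: "0 < \<kappa>" "ln (1 / x) < \<kappa>" and c: "2 * sqrt (\<kappa> / pi) < c"
  shows "\<forall>\<^sub>F n in sequentially. expect n (\<lambda>t. real (num_unordered t)) \<le> c * log_scale n"
    and "(\<lambda>n. measure_pmf.prob (random_binary_tree n) {t. real (num_unordered t) \<le> c * log_scale n}) \<longlonglongrightarrow> 1"
proof -
  define k where "k n = nat \<lfloor>ln (real n) / \<kappa>\<rfloor>" for n
  have k: "(\<lambda>n. real (k n) / ln (real n)) \<longlonglongrightarrow> 1 / \<kappa>"
    unfolding k_def by (rule log_floor_asymptotics[OF \<kappa>(1)])
  note k_lims = log_scale_asymptotics[OF \<kappa>(1) k]
  have B1: "B \<ge> 1" using B[of 0] by simp
  define a where "a = ln (1 / x) / \<kappa>"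
  have a: "a < 1" using \<kappa> by (simp add: a_def)
  \<comment> \<open>One bound for both claims; the summand n^(3/4) is the deviation permitted in the
    second.\<close>
  define V where "V n = B * real n powr a + 2 * (real n + 1) * central (Suc (k n)) + real n powr (3/4)" for n
  have V: "(\<lambda>n. V n / log_scale n) \<longlonglongrightarrow> 2 * sqrt (\<kappa> / pi)"
  proof -
    have "(\<lambda>n. B * (real n powr (a - 1) * sqrt (ln (real n))) + 2 * ((real n + 1) / real n * (central (Suc (k n)) * sqrt (ln (real n))))
        + real n powr (-1/4) * sqrt (ln (real n))) \<longlonglongrightarrow> B * 0 + 2 * (1 * sqrt (\<kappa> / pi)) + 0"
    proof (intro tendsto_add tendsto_mult tendsto_const central_log_asymptotics)
      show "(\<lambda>n. (real n + 1) / real n) \<longlonglongrightarrow> 1" by real_asymp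
      show "filterlim (\<lambda>n. Suc (k n)) at_top sequentially"
        by (rule filterlim_compose[OF filterlim_Suc k_lims(1)])
      show "(\<lambda>n. real n powr (-1/4) * sqrt (ln (real n))) \<longlonglongrightarrow> 0" by real_asymp
      show "(\<lambda>n. real n powr (a - 1) * sqrt (ln (real n))) \<longlonglongrightarrow> 0" using a by real_asymp
    qed (rule k_lims)
    moreover have "\<forall>\<^sub>F n in sequentially. B * (real n powr (a - 1) * sqrt (ln (real n))) + 2 * ((real n + 1) / real n * (central (Suc (k n)) * sqrt (ln (real n))))
        + real n powr (-1/4) * sqrt (ln (real n)) = V n / log_scale n"
      using eventually_gt_at_top[of 1]
    proof eventually_elim
      case (elim n)
      have p: "real n powr (3/4) = real n powr (-1/4) * real n" "real n powr a = real n powr (a - 1) * real n"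
        using elim powr_add[of "real n" "-1/4" 1] powr_add[of "real n" "a - 1" 1] by simp_all
      show ?case using elim unfolding V_def log_scale_def p
        by (simp add: field_simps)
    qed
    ultimately show ?thesis by (simp add: Lim_transform_eventually)
  qed
  let ?f = "\<lambda>n s. of_bool (0 < size (s :: unit tree) \<and> size s \<le> k n)"
  have bound: "real (num_unordered t) \<le> B * real n powr a + real n - fringe_sum (?f n) t" if "n > 1" "size t = n" for n and t :: "unit tree"
  proof -
    have "real (k n) \<le> ln (real n) / \<kappa>"
      using \<kappa>(1) that(1) unfolding k_def by (intro of_nat_floor) auto
    then have "ln (1 / x) * real (k n) \<le> ln (1 / x) * (ln (real n) / \<kappa>)"
      using x by (intro mult_left_mono) auto
    then have "(1 / x) powr real (k n) \<le> real n powr a"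
      using x that(1) by (simp add: powr_def a_def mult_ac)
    then have "(1 / x) ^ k n \<le> real n powr a" using x by (simp add: powr_realpow)
    then have "B * (1 / x) ^ k n \<le> B * real n powr a" using B1 by (intro mult_left_mono) auto
    then show ?thesis using num_unordered_le[OF B x, of t "k n"] that(2) by simp
  qed
  have \<phi>: "(real n + 1) * (\<Sum>i\<le>n. tree_gf (?f n) $ i) = (real n + 1) - 2 * (real n + 1) * central (Suc (k n))" if "k n \<le> n" for n
  proof -
    \<comment> \<open>The nonempty trees have total weight 1, because \<open>central 1\<close> is
      1/2.\<close>
    have "(\<Sum>i\<le>n. tree_gf (?f n) $ i) = 1 - 2 * central (Suc (k n))"
      using sum_tree_gf_window[of 0 "k n" n] that central_Suc[of 0] by simp
    then show ?thesis by (simp only:) (simp add: algebra_simps)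
  qed
  have k_le: "\<forall>\<^sub>F n in sequentially. k n \<le> n"
  proof -
    have "(\<lambda>n. (real (k n) / ln (real n)) * (ln (real n) / real n)) \<longlonglongrightarrow> 1 / \<kappa> * 0"
    proof (intro tendsto_mult k)
      show "(\<lambda>n. ln (real n) / real n) \<longlonglongrightarrow> 0" by real_asymp
    qed
    then have "\<forall>\<^sub>F n in sequentially. (real (k n) / ln (real n)) * (ln (real n) / real n) < 1"
      by (intro order_tendstoD(2)) auto
    then show ?thesis using eventually_gt_at_top[of 1]
      by eventually_elim (simp add: field_simps)
  qed
  show "\<forall>\<^sub>F n in sequentially. expect n (\<lambda>t. real (num_unordered t)) \<le> c * log_scale n"
    using eventually_gt_at_top[of 1] k_le order_tendstoD(2)[OF V c] eventually_log_scale_pos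
  proof eventually_elim
    case (elim n)
    have "expect n (\<lambda>t. real (num_unordered t)) \<le> expect n (\<lambda>t. (B * real n powr a + real n) - fringe_sum (?f n) t)"
      by (rule expect_mono) (use bound[OF elim(1)] in auto)
    also have "\<dots> = B * real n powr a + real n - expect n (fringe_sum (?f n))"
      by (simp only: expect_diff expect_const)
    also have "\<dots> \<le> B * real n powr a + real n - (real n + 1) * (\<Sum>i\<le>n. tree_gf (?f n) $ i)"
      by (intro diff_left_mono expect_fringe_sum_ge) auto
    also have "\<dots> \<le> V n" unfolding \<phi>[OF elim(2)] V_def using powr_ge_zero[of "real n" "3/4"] by linarith
    also have "\<dots> \<le> c * log_scale n" using elim by (simp add: field_simps)
    finally show ?case .
  qed
  define b where "b n = 1 - 2 * real (k n) * real n / (real n powr (3/4))\<^sup>2 - 0" for n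
  have "(\<lambda>n. 2 * (real (k n) / ln (real n)) * (ln (real n) / sqrt (real n))) \<longlonglongrightarrow> 2 * (1 / \<kappa>) * 0"
  proof (intro tendsto_mult tendsto_const k)
    show "(\<lambda>n. ln (real n) / sqrt (real n)) \<longlonglongrightarrow> 0" by real_asymp
  qed
  moreover have "\<forall>\<^sub>F n in sequentially. 2 * (real (k n) / ln (real n)) * (ln (real n) / sqrt (real n))
      = 2 * real (k n) * real n / (real n powr (3/4))\<^sup>2"
    using eventually_gt_at_top[of 1]
  proof eventually_elim
    case (elim n)
    have "(real n powr (3/4))\<^sup>2 = real n powr (3/2)"
      by (simp flip: powr_add add: power2_eq_square)
    also have "\<dots> = real n powr (1/2) * real n"
      using elim powr_add[of "real n" "1/2" 1] by simp
    also have "\<dots> = sqrt (real n) * real n" using elim by (simp add: powr_half_sqrt)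
    finally show ?case using elim by simp
  qed
  ultimately have "(\<lambda>n. 2 * real (k n) * real n / (real n powr (3/4))\<^sup>2) \<longlonglongrightarrow> 0"
    by (simp add: Lim_transform_eventually)
  then have "b \<longlonglongrightarrow> 1 - 0 - 0" unfolding b_def by (intro tendsto_diff tendsto_const)
  then have b: "b \<longlonglongrightarrow> 1" by simp
  have "\<forall>\<^sub>F n in sequentially. b n \<le> measure_pmf.prob (random_binary_tree n) {t. real (num_unordered t) \<le> c * log_scale n}"
    using eventually_gt_at_top[of 1] k_le order_tendstoD(2)[OF V c] eventually_log_scale_pos
  proof eventually_elim
    case (elim n)
    let ?G = "(real n + 1) * (\<Sum>i\<le>n. tree_gf (?f n) $ i) - real n powr (3/4)"
    have F: "measure_pmf.prob (random_binary_tree n) {t. fringe_sum (?f n) t \<le> ?G} \<le> 2 * real (k n) * real n / (real n powr (3/4))\<^sup>2"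
      using elim(1) by (intro prob_fringe_sum_less) auto
    have Vc: "V n \<le> c * log_scale n" using elim by (simp add: field_simps)
    \<comment> \<open>Here there is only one exceptional event, so the second one is taken to be
      impossible.\<close>
    have "1 - measure_pmf.prob (random_binary_tree n) {t. fringe_sum (?f n) t \<le> ?G} - measure_pmf.prob (random_binary_tree n) {t. False}
       \<le> measure_pmf.prob (random_binary_tree n) {t. real (num_unordered t) \<le> c * log_scale n}"
    proof (rule prob_tree_le_1_minus)
      fix t :: "unit tree"
      assume "size t = n" "\<not> real (num_unordered t) \<le> c * log_scale n"
      then show "fringe_sum (?f n) t \<le> ?G \<or> False"
        using bound[OF elim(1), of t] Vc unfolding \<phi>[OF elim(2)] V_def by linarith
    qed
    then show ?case using F unfolding b_def by simp
  qed
  then show "(\<lambda>n. measure_pmf.prob (random_binary_tree n) {t. real (num_unordered t) \<le> c * log_scale n}) \<longlonglongrightarrow> 1"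
    by (rule real_tendsto_sandwich[OF _ _ b tendsto_const]) simp
qed

lemma real_less_2_sqrt_iff: "0 \<le> c \<Longrightarrow> c < 2 * sqrt (k / pi) \<longleftrightarrow> c\<^sup>2 * pi / 4 < k"
  and real_2_sqrt_less_iff: "0 \<le> c \<Longrightarrow> 2 * sqrt (k / pi) < c \<longleftrightarrow> k < c\<^sup>2 * pi / 4"
proof -
  assume c: "0 \<le> c"
  have e: "2 * sqrt (k / pi) = sqrt (4 * k / pi)" by (simp add: real_sqrt_mult real_sqrt_divide)
  have s: "c = sqrt (c\<^sup>2)" using c by simp
  show "c < 2 * sqrt (k / pi) \<longleftrightarrow> c\<^sup>2 * pi / 4 < k"
    unfolding e by (subst s, subst real_sqrt_less_iff) (simp add: field_simps)
  show "2 * sqrt (k / pi) < c \<longleftrightarrow> k < c\<^sup>2 * pi / 4"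
    unfolding e by (subst s, subst real_sqrt_less_iff) (simp add: field_simps)
qed

theorem theorem3:
  shows "\<exists>c\<^sub>1 c\<^sub>2 :: real.
    \<bar>c\<^sub>1 - 1.0591261434\<bar> \<le> 5 / 10 ^ 11 \<and> \<bar>c\<^sub>2 - 1.0761505454\<bar> \<le> 5 / 10 ^ 11 \<and>
    (\<exists>\<delta> \<epsilon> :: nat \<Rightarrow> real. \<delta> \<in> o(\<lambda>_. 1) \<and> \<epsilon> \<in> o(\<lambda>_. 1) \<and>
      (\<forall>\<^sub>F n in sequentially.
        c\<^sub>1 * (real n / sqrt (ln (real n))) * (1 + \<delta> n)
          \<le> measure_pmf.expectation (random_binary_tree n) (\<lambda>t. real (num_unordered t)) \<and>
        measure_pmf.expectation (random_binary_tree n) (\<lambda>t. real (num_unordered t))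
          \<le> c\<^sub>2 * (real n / sqrt (ln (real n))) * (1 + \<epsilon> n))) \<and>
    (\<exists>\<delta> \<epsilon> :: nat \<Rightarrow> real. \<delta> \<in> o(\<lambda>_. 1) \<and> \<epsilon> \<in> o(\<lambda>_. 1) \<and>
      (\<lambda>n. measure_pmf.prob (random_binary_tree n)
         {t. c\<^sub>1 * (real n / sqrt (ln (real n))) * (1 + \<delta> n) \<le> real (num_unordered t) \<and>
             real (num_unordered t) \<le> c\<^sub>2 * (real n / sqrt (ln (real n))) * (1 + \<epsilon> n)})
        \<longlonglongrightarrow> 1)"
proof -
  \<comment> \<open>The ends of the two permitted intervals that make both inequalities
    weakest.\<close>
  define c1 c2 :: real where "c1 = 1.05912614335" and "c2 = 1.07615054545"
  obtain h where h: "c1\<^sup>2 * pi / 4 < 0.88101896629" "0.88101896629 < ln 2 * (1 + shape_sum (1 / 16) 2 h / 4)"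
    using lower_constant by (auto simp: c1_def)
  have c1: "c1 < 2 * sqrt (0.88101896629 / pi)"
    by (subst real_less_2_sqrt_iff) (use h(1) in \<open>simp_all add: c1_def\<close>)
  \<comment> \<open>The bound on the mean needs the tail bound at a slightly larger
    constant.\<close>
  then obtain c1' where c1': "c1 < c1'" "c1' < 2 * sqrt (0.88101896629 / pi)" using dense by blast
  have low: "(\<lambda>n. measure_pmf.prob (random_binary_tree n) {t. c1 * log_scale n \<le> real (num_unordered t)}) \<longlonglongrightarrow> 1"
    by (rule num_unordered_lower_tail[OF _ h(2) c1]) simp
  have low_mean: "\<forall>\<^sub>F n in sequentially. c1 * log_scale n \<le> expect n (\<lambda>t. real (num_unordered t))"
    by (rule num_unordered_lower_mean[OF c1'(1) _ num_unordered_lower_tail[OF _ h(2) c1'(2)]]) (simp_all add: c1_def)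
  have c2: "2 * sqrt (0.90956961022 / pi) < c2"
    by (subst real_2_sqrt_less_iff) (use upper_constant in \<open>simp_all add: c2_def\<close>)
  have up_mean: "\<forall>\<^sub>F n in sequentially. expect n (\<lambda>t. real (num_unordered t)) \<le> c2 * log_scale n"
    and up: "(\<lambda>n. measure_pmf.prob (random_binary_tree n) {t. real (num_unordered t) \<le> c2 * log_scale n}) \<longlonglongrightarrow> 1"
    using num_unordered_upper[OF shape_sum_half_bounded _ _ _ _ c2] ln_beta_upper by simp_all
  let ?p = "\<lambda>n. measure_pmf.prob (random_binary_tree n)"
  \<comment> \<open>The two one-sided events are combined by P(A and B) \<ge> P(A) + P(B) -
    1.\<close>
  have "(\<lambda>n. ?p n {t. c1 * log_scale n \<le> real (num_unordered t)} + ?p n {t. real (num_unordered t) \<le> c2 * log_scale n} - 1) \<longlonglongrightarrow> 1 + 1 - 1"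
    by (intro tendsto_intros low up)
  then have lim: "(\<lambda>n. ?p n {t. c1 * log_scale n \<le> real (num_unordered t)} + ?p n {t. real (num_unordered t) \<le> c2 * log_scale n} - 1) \<longlonglongrightarrow> 1"
    by simp
  have le: "?p n {t. c1 * log_scale n \<le> real (num_unordered t)} + ?p n {t. real (num_unordered t) \<le> c2 * log_scale n} - 1
      \<le> ?p n {t. c1 * log_scale n \<le> real (num_unordered t) \<and> real (num_unordered t) \<le> c2 * log_scale n}" for n
    using prob_tree_le_1_minus[of n "\<lambda>t. c1 * log_scale n \<le> real (num_unordered t) \<and> real (num_unordered t) \<le> c2 * log_scale n"
        "\<lambda>t. \<not> c1 * log_scale n \<le> real (num_unordered t)" "\<lambda>t. \<not> real (num_unordered t) \<le> c2 * log_scale n"]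
    unfolding prob_tree_not by simp
  have both: "(\<lambda>n. ?p n {t. c1 * log_scale n \<le> real (num_unordered t) \<and> real (num_unordered t) \<le> c2 * log_scale n}) \<longlonglongrightarrow> 1"
    by (rule real_tendsto_sandwich[OF always_eventually[OF allI[OF le]] _ lim tendsto_const]) simp
  have 1: "\<bar>c1 - 1.0591261434\<bar> \<le> 5 / 10 ^ 11" and 2: "\<bar>c2 - 1.0761505454\<bar> \<le> 5 / 10 ^ 11"
    by (simp_all add: c1_def c2_def)
  have 3: "\<exists>\<delta> \<epsilon> :: nat \<Rightarrow> real. \<delta> \<in> o(\<lambda>_. 1) \<and> \<epsilon> \<in> o(\<lambda>_. 1) \<and>
      (\<forall>\<^sub>F n in sequentially.
        c1 * (real n / sqrt (ln (real n))) * (1 + \<delta> n) \<le> expect n (\<lambda>t. real (num_unordered t)) \<and>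
        expect n (\<lambda>t. real (num_unordered t)) \<le> c2 * (real n / sqrt (ln (real n))) * (1 + \<epsilon> n))"
    by (rule exI[of _ "\<lambda>_. 0"], rule exI[of _ "\<lambda>_. 0"])
      (use eventually_conj[OF low_mean up_mean] in \<open>simp add: log_scale_def\<close>)
  have 4: "\<exists>\<delta> \<epsilon> :: nat \<Rightarrow> real. \<delta> \<in> o(\<lambda>_. 1) \<and> \<epsilon> \<in> o(\<lambda>_. 1) \<and>
      (\<lambda>n. ?p n {t. c1 * (real n / sqrt (ln (real n))) * (1 + \<delta> n) \<le> real (num_unordered t) \<and>
             real (num_unordered t) \<le> c2 * (real n / sqrt (ln (real n))) * (1 + \<epsilon> n)}) \<longlonglongrightarrow> 1"
    by (rule exI[of _ "\<lambda>_. 0"], rule exI[of _ "\<lambda>_. 0"]) (use both in \<open>simp add: log_scale_def\<close>)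
  show ?thesis
    by (rule exI[of _ c1], rule exI[of _ c2]) (intro conjI 1 2 3 4)
qed

end
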